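(* Let $\ell \le 5$ and let $G$ be a $3$-colorable $B+E_\ell$ graph. Then $\mathrm{Kc}(G,4) = 1$, i.e., any two $4$-colorings of $G$ are Kempe equivalent.
   Context: All graphs are finite and simple. A $k$-coloring of a graph $G$ is a map $c: V(G) \to \{1,\dots,k\}$ with $c(u)\neq c(v)$ for every edge $uv$ (not all colors need be used); $G$ is $k$-colorable if it has one. For a colored graph and distinct colors $i,j$, $G(i,j)$ is the subgraph induced by the vertices colored $i$ or $j$; a Kempe change is the operation of swapping colors $i$ and $j$ on one connected component of $G(i,j)$. Two $k$-colorings are Kempe equivalent if one can be obtained from the other by a finite sequence of Kempe changes (possibly with different color pairs from $\{1,\dots,k\}$). $\mathrm{Kc}(G,k)$ is the number of Kempe equivalence classes of $k$-colorings of $G$. A $B+E_\ell$ graph is a graph obtained from a bipartite graph $B$ with partite sets $S$ and $T$ by adding $\ell$ new edges, each joining two vertices lying in the same partite set. *)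

theory Defs
  imports Main "HOL-Library.FuncSet"
begin

type_synonym 'a ugraph = "'a set \<times> 'a set set"

abbreviation verts :: "'a ugraph \<Rightarrow> 'a set" where "verts G \<equiv> fst G"
abbreviation edges :: "'a ugraph \<Rightarrow> 'a set set" where "edges G \<equiv> snd G"

definition simple_graph :: "'a ugraph \<Rightarrow> bool" where
  "simple_graph G \<longleftrightarrow> finite (verts G) \<and> (\<forall>e\<in>edges G. e \<subseteq> verts G \<and> card e = 2)"

definition induced_subgraph :: "'a ugraph \<Rightarrow> 'a set \<Rightarrow> 'a ugraph" where
  "induced_subgraph G W = (verts G \<inter> W, {e \<in> edges G. e \<subseteq> W})"

definition adj :: "'a ugraph \<Rightarrow> 'a rel" where
  "adj G = {(u, v). {u, v} \<in> edges G}"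

text \<open>Connected components are given by their vertex sets.\<close>

definition components :: "'a ugraph \<Rightarrow> 'a set set" where
  "components G = verts G // {(u, v). u \<in> verts G \<and> v \<in> verts G \<and> (u, v) \<in> (adj G)\<^sup>*}"

definition bipartite :: "'a ugraph \<Rightarrow> 'a set \<Rightarrow> 'a set \<Rightarrow> bool" where
  "bipartite B S T \<longleftrightarrow> simple_graph B \<and> S \<union> T = verts B \<and> S \<inter> T = {} \<and>
     (\<forall>e\<in>edges B. \<exists>s\<in>S. \<exists>t\<in>T. e = {s, t})"

text \<open>An edge of \<open>F\<close> is never an edge of \<open>B\<close>, since the latter join \<open>S\<close> to \<open>T\<close>;
  hence \<open>F\<close> consists of exactly \<open>l\<close> new edges.\<close>

definition bipartite_plus :: "nat \<Rightarrow> 'a ugraph \<Rightarrow> bool" where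
  "bipartite_plus l G \<longleftrightarrow> (\<exists>B S T F. bipartite B S T \<and>
     finite F \<and> card F = l \<and> (\<forall>e\<in>F. card e = 2 \<and> (e \<subseteq> S \<or> e \<subseteq> T)) \<and>
     G = (verts B, edges B \<union> F))"

text \<open>Colorings are taken extensional, i.e. \<open>undefined\<close> off the vertex set, so that
  distinct elements of this set are distinct as maps on the vertices.\<close>

definition colorings :: "'a ugraph \<Rightarrow> nat \<Rightarrow> ('a \<Rightarrow> nat) set" where
  "colorings G k = {c \<in> verts G \<rightarrow>\<^sub>E {1..k}. \<forall>u v. {u, v} \<in> edges G \<longrightarrow> c u \<noteq> c v}"

definition colorable :: "'a ugraph \<Rightarrow> nat \<Rightarrow> bool" where
  "colorable G k \<longleftrightarrow> colorings G k \<noteq> {}"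

definition color_subgraph :: "'a ugraph \<Rightarrow> ('a \<Rightarrow> nat) \<Rightarrow> nat \<Rightarrow> nat \<Rightarrow> 'a ugraph" where
  "color_subgraph G c i j = induced_subgraph G {v \<in> verts G. c v = i \<or> c v = j}"

definition swap_on :: "'a set \<Rightarrow> nat \<Rightarrow> nat \<Rightarrow> ('a \<Rightarrow> nat) \<Rightarrow> 'a \<Rightarrow> nat" where
  "swap_on C i j c = (\<lambda>v. if v \<in> C then (if c v = i then j else if c v = j then i else c v) else c v)"

definition kempe_change :: "'a ugraph \<Rightarrow> nat \<Rightarrow> ('a \<Rightarrow> nat) rel" where
  "kempe_change G k = {(c, d). c \<in> colorings G k \<and>
     (\<exists>i\<in>{1..k}. \<exists>j\<in>{1..k}. i \<noteq> j \<and>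
        (\<exists>C\<in>components (color_subgraph G c i j). d = swap_on C i j c))}"

definition kempe_equiv :: "'a ugraph \<Rightarrow> nat \<Rightarrow> ('a \<Rightarrow> nat) rel" where
  "kempe_equiv G k = {(c, d). c \<in> colorings G k \<and> d \<in> colorings G k \<and> (c, d) \<in> (kempe_change G k)\<^sup>*}"

definition Kc :: "'a ugraph \<Rightarrow> nat \<Rightarrow> nat" where
  "Kc G k = card (colorings G k // kempe_equiv G k)"

lemma adj_sym: "sym (adj G)"
  by (auto simp: adj_def sym_def insert_commute)

lemma component_closed:
  assumes "C \<in> components H" "u \<in> C" "v \<in> verts H" "{u, v} \<in> edges H"
  shows "v \<in> C"
proof -
  obtain x where x: "x \<in> verts H"
    "C = {(u, v). u \<in> verts H \<and> v \<in> verts H \<and> (u, v) \<in> (adj H)\<^sup>*} `` {x}"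
    using assms(1) unfolding components_def by (auto elim!: quotientE)
  have "(x, u) \<in> (adj H)\<^sup>*" "(u, v) \<in> adj H"
    using assms x by (auto simp: adj_def)
  then show ?thesis using x assms(3) by (auto intro: rtrancl_into_rtrancl)
qed

lemma component_subset: "C \<in> components H \<Longrightarrow> C \<subseteq> verts H"
  unfolding components_def by (auto elim!: quotientE)

lemma kempe_change_in_colorings:
  assumes G: "simple_graph G" and cd: "(c, d) \<in> kempe_change G k"
  shows "d \<in> colorings G k"
proof -
  obtain i j C where c: "c \<in> colorings G k" and ij: "i \<in> {1..k}" "j \<in> {1..k}" "i \<noteq> j"
    and C: "C \<in> components (color_subgraph G c i j)" and d: "d = swap_on C i j c"
    using cd unfolding kempe_change_def by auto
  have sub: "v \<in> verts G \<and> (c v = i \<or> c v = j)" if "v \<in> C" for v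
    using component_subset[OF C] that by (auto simp: color_subgraph_def induced_subgraph_def)
  have cl: "v \<in> C" if "u \<in> C" "{u, v} \<in> edges G" "c v = i \<or> c v = j" for u v
  proof -
    have "v \<in> verts G" using G that by (auto simp: simple_graph_def)
    then show ?thesis
      using component_closed[OF C, of u v] that sub[of u]
      by (auto simp: color_subgraph_def induced_subgraph_def)
  qed
  have "d \<in> verts G \<rightarrow>\<^sub>E {1..k}"
    using c ij sub unfolding d swap_on_def colorings_def
    by (auto simp: PiE_iff extensional_def)
  moreover have "d u \<noteq> d v" if e: "{u, v} \<in> edges G" for u v
  proof -
    have "{v, u} \<in> edges G" using e by (simp add: insert_commute)
    then have "c u \<noteq> c v" using c e by (auto simp: colorings_def)
    then show ?thesis
      using cl[OF _ e] cl[OF _ \<open>{v, u} \<in> edges G\<close>] sub[of u] sub[of v] ij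
      unfolding d swap_on_def by auto
  qed
  ultimately show ?thesis by (auto simp: colorings_def)
qed

lemma kempe_change_sym:
  assumes G: "simple_graph G"
  shows "sym (kempe_change G k)"
proof (rule symI)
  fix c d assume cd: "(c, d) \<in> kempe_change G k"
  then obtain i j C where ij: "i \<in> {1..k}" "j \<in> {1..k}" "i \<noteq> j"
    and C: "C \<in> components (color_subgraph G c i j)" and d: "d = swap_on C i j c"
    unfolding kempe_change_def by auto
  have sub: "c v = i \<or> c v = j" if "v \<in> C" for v
    using component_subset[OF C] that by (auto simp: color_subgraph_def induced_subgraph_def)
  have "{v \<in> verts G. d v = i \<or> d v = j} = {v \<in> verts G. c v = i \<or> c v = j}"
    unfolding d swap_on_def using sub by auto
  then have "color_subgraph G d i j = color_subgraph G c i j"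
    by (simp add: color_subgraph_def)
  moreover have "c = swap_on C i j d"
    unfolding d swap_on_def using ij by (auto simp: fun_eq_iff)
  ultimately have "\<exists>C\<in>components (color_subgraph G d i j). c = swap_on C i j d"
    using C by metis
  with ij have "\<exists>i\<in>{1..k}. \<exists>j\<in>{1..k}. i \<noteq> j \<and>
      (\<exists>C\<in>components (color_subgraph G d i j). c = swap_on C i j d)"
    by blast
  with kempe_change_in_colorings[OF G cd] show "(d, c) \<in> kempe_change G k"
    unfolding kempe_change_def by blast
qed

lemma equiv_kempe_equiv:
  assumes "simple_graph G"
  shows "equiv (colorings G k) (kempe_equiv G k)"
proof (rule equivI)
  show "sym (kempe_equiv G k)"
    using sym_rtrancl[OF kempe_change_sym[OF assms]]
    by (auto simp: kempe_equiv_def sym_def)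
qed (auto simp: kempe_equiv_def refl_on_def trans_def)

lemma bipartite_plus_simple: "bipartite_plus l G \<Longrightarrow> simple_graph G"
  by (fastforce simp: bipartite_plus_def bipartite_def simple_graph_def)

end

theory Submission
  imports Defs
begin

text \<open>Two proper colorings that differ only by exchanging colors \<open>i\<close> and \<open>j\<close> are Kempe equivalent.
  There are six pairs of colors and at most five non-bipartite edges, so some pair occurs on none
  of these edges; recoloring its vertices according to their side removes one color from \<open>S\<close>.
  If \<open>T\<close> is the side with fewer added edges, one reaches a coloring in which color 4 is used
  exactly on \<open>T - Q\<close>, where \<open>Q\<close> has at most one vertex for each of the at most two edges inside \<open>T\<close>.
  The given 3-coloring is equivalent to one of the same form. It remains to compare 3-colorings
  of the graph on \<open>S \<union> Q\<close>, where vertices of degree at most two can be deleted. This suffices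
  unless \<open>Q\<close> consists of two vertices of different colors that cannot be made equal; then the
  edges inside \<open>S\<close> form a path with three edges, and a vertex of \<open>Q\<close> has to be replaced by its
  neighbor in \<open>T\<close>, which is possible because the graph is 3-colorable. In that case all colorings
  are equivalent to those with colors 1, 2 on \<open>S\<close> and 3, 4 on \<open>T\<close>.\<close>

section \<open>Recolorings with two colors\<close>

text \<open>The number five does more than leave a free pair of colors: it also bounds the cores
  that survive the deletion of vertices. A graph on \<open>S\<close> plus one further vertex with
  all degrees at least three needs too many edges inside \<open>S\<close>, up to two small
  exceptions. With two further vertices \<open>p\<close> and \<open>r\<close> of different colors
  the count no longer suffices, and there is a genuine obstruction: a path \<open>x\<close>,
  \<open>u\<close>, \<open>v\<close>, \<open>y\<close> inside \<open>S\<close> together with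
  \<open>p\<close> and \<open>r\<close> can form a triangular prism. With only three colors
  available, the colorings of the prism fall into two Kempe classes; \<open>p\<close> and
  \<open>r\<close> have equal colors in one class and different colors in the other. So a fixed
  \<open>Q\<close> need not suffice, and the fourth color has to be brought in again by changing
  \<open>Q\<close>. Colorings with different \<open>Q\<close> are then compared through colorings
  with 1, 2 on \<open>S\<close> and 3, 4 on \<open>T\<close>, a form that does not refer to
  \<open>Q\<close>; in the prism case they exist because the edges inside \<open>S\<close> form a
  path, which is bipartite.\<close>

definition proper :: "'a ugraph \<Rightarrow> nat \<Rightarrow> ('a \<Rightarrow> nat) \<Rightarrow> bool" where
  "proper G k c \<longleftrightarrow> (\<forall>v\<in>verts G. c v \<in> {1..k}) \<and> (\<forall>u v. {u, v} \<in> edges G \<longrightarrow> c u \<noteq> c v)"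

text \<open>Restricting both arguments absorbs the extensionality of \<open>colorings\<close>, so
  recolorings can be written as plain updates and lambda terms whose values off the graph do not
  matter.\<close>

definition keq :: "'a ugraph \<Rightarrow> nat \<Rightarrow> ('a \<Rightarrow> nat) \<Rightarrow> ('a \<Rightarrow> nat) \<Rightarrow> bool" where
  "keq G k c d \<longleftrightarrow> (restrict c (verts G), restrict d (verts G)) \<in> kempe_equiv G k"

lemma restrict_coloring_iff:
  assumes "simple_graph G"
  shows "restrict c (verts G) \<in> colorings G k \<longleftrightarrow> proper G k c"
proof -
  have "u \<in> verts G \<and> v \<in> verts G" if "{u, v} \<in> edges G" for u v
    using assms that by (auto simp: simple_graph_def)
  then show ?thesis
    by (auto simp: colorings_def proper_def PiE_iff)
qed

lemma coloring_proper: "simple_graph G \<Longrightarrow> c \<in> colorings G k \<Longrightarrow> proper G k c"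
  by (auto simp: colorings_def proper_def)

lemma coloring_restrict: "c \<in> colorings G k \<Longrightarrow> restrict c (verts G) = c"
  by (auto simp: colorings_def PiE_iff extensional_restrict)

lemma keq_refl: "simple_graph G \<Longrightarrow> proper G k c \<Longrightarrow> keq G k c c"
  by (simp add: keq_def kempe_equiv_def restrict_coloring_iff)

lemma keq_sym: "simple_graph G \<Longrightarrow> keq G k c d \<Longrightarrow> keq G k d c"
  using equiv_kempe_equiv[of G k] by (auto simp: keq_def equiv_def dest: symD)

lemma keq_trans: "simple_graph G \<Longrightarrow> keq G k c d \<Longrightarrow> keq G k d e \<Longrightarrow> keq G k c e"
  using equiv_kempe_equiv[of G k] by (auto simp: keq_def equiv_def dest: transD)

lemma keq_proper: "simple_graph G \<Longrightarrow> keq G k c d \<Longrightarrow> proper G k c \<and> proper G k d"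
  by (auto simp: keq_def kempe_equiv_def restrict_coloring_iff)

lemma rtrancl_component:
  assumes "v \<in> verts H"
  shows "{w \<in> verts H. (v, w) \<in> (adj H)\<^sup>*} \<in> components H"
proof -
  have "{w \<in> verts H. (v, w) \<in> (adj H)\<^sup>*} =
      {(u, v). u \<in> verts H \<and> v \<in> verts H \<and> (u, v) \<in> (adj H)\<^sup>*} `` {v}"
    using assms by auto
  then show ?thesis
    unfolding components_def using assms by (simp only: quotientI)
qed

text \<open>Disagreement spreads along an \<open>i\<close>-\<open>j\<close> component of
  \<open>c\<close>: two adjacent vertices colored from \<open>{i, j}\<close> in both colorings
  either both agree or both disagree. Swapping a component that contains a disagreement therefore
  makes \<open>c\<close> equal to \<open>d\<close> on all of it, and the number of disagreements
  drops.\<close>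

lemma keq_two_colors:
  assumes G: "simple_graph G" and c: "proper G k c" and d: "proper G k d"
    and cd: "\<And>v. v \<in> verts G \<Longrightarrow> c v = d v \<or> c v \<in> {i, j} \<and> d v \<in> {i, j}"
  shows "keq G k c d"
  using c cd
proof (induction "card {v \<in> verts G. c v \<noteq> d v}" arbitrary: c rule: less_induct)
  case less
  have fin: "finite (verts G)" using G by (simp add: simple_graph_def)
  show ?case
  proof (cases "\<exists>v\<in>verts G. c v \<noteq> d v")
    case False
    then have "restrict c (verts G) = restrict d (verts G)" by (auto simp: fun_eq_iff restrict_def)
    then show ?thesis using keq_refl[OF G d] by (simp add: keq_def)
  next
    case True
    then obtain v where v: "v \<in> verts G" "c v \<noteq> d v" by blast
    have "c v \<in> {1..k}" "d v \<in> {1..k}" using v less.prems(1) d unfolding proper_def by blast+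
    then have ij: "i \<noteq> j" "i \<in> {1..k}" "j \<in> {1..k}" "c v = i \<or> c v = j"
      using v less.prems(2)[OF v(1)] by auto
    let ?c = "restrict c (verts G)"
    define H where "H = color_subgraph G ?c i j"
    have vH: "v \<in> verts H" using v ij by (auto simp: H_def color_subgraph_def induced_subgraph_def)
    define C where "C = {w \<in> verts H. (v, w) \<in> (adj H)\<^sup>*}"
    have C: "C \<in> components H" unfolding C_def using vH by (rule rtrancl_component)
    have H_sub: "w \<in> verts G \<and> c w \<in> {i, j}" if "w \<in> verts H" for w
      using that by (auto simp: H_def color_subgraph_def induced_subgraph_def)
    have "w \<in> verts H \<and> c w \<noteq> d w" if "(v, w) \<in> (adj H)\<^sup>*" for w
      using that
    proof (induction rule: rtrancl_induct)
      case base then show ?case using v vH by simp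
    next
      case (step y z)
      have yz: "{y, z} \<in> edges G" "z \<in> verts G" "z \<in> verts H"
        using step(2) G
        by (auto simp: adj_def H_def color_subgraph_def induced_subgraph_def simple_graph_def)
      have "c y \<noteq> c z" "d y \<noteq> d z" using yz less.prems(1) d by (auto simp: proper_def)
      moreover have "c y \<noteq> d y" "y \<in> verts G" "c y \<in> {i, j}" "c z \<in> {i, j}"
        using step.IH H_sub yz(3) by blast+
      moreover from this have "d y \<in> {i, j}" using less.prems(2) by metis
      ultimately have "c z \<noteq> d z" by force
      then show ?case using yz(3) by blast
    qed
    then have diff: "w \<in> verts G \<and> c w \<noteq> d w \<and> c w \<in> {i, j} \<and> d w \<in> {i, j}" if "w \<in> C" for w
      using that H_sub less.prems(2) unfolding C_def by blast
    define c1 where "c1 = swap_on C i j ?c"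
    have c1_eq: "c1 w = (if w \<in> C then d w else ?c w)" for w
      using diff[of w] ij(1) by (auto simp: c1_def swap_on_def)
    have col: "?c \<in> colorings G k" using less.prems(1) by (simp add: restrict_coloring_iff G)
    have step: "(?c, c1) \<in> kempe_change G k"
      unfolding kempe_change_def c1_def using col ij(1-3) C[unfolded H_def] by blast
    have c1_col: "c1 \<in> colorings G k" using kempe_change_in_colorings[OF G step] .
    then have c1p: "proper G k c1" by (rule coloring_proper[OF G])
    have "keq G k c c1"
      using step col c1_col by (auto simp: keq_def kempe_equiv_def coloring_restrict)
    moreover have "keq G k c1 d"
    proof (rule less.hyps[OF _ c1p])
      have "v \<in> C" using vH by (simp add: C_def)
      then have "{w \<in> verts G. c1 w \<noteq> d w} \<subset> {w \<in> verts G. c w \<noteq> d w}"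
        using v by (auto simp: c1_eq)
      then show "card {w \<in> verts G. c1 w \<noteq> d w} < card {w \<in> verts G. c w \<noteq> d w}"
        using fin by (intro psubset_card_mono) auto
      show "c1 w = d w \<or> c1 w \<in> {i, j} \<and> d w \<in> {i, j}" if "w \<in> verts G" for w
        using less.prems(2)[OF that] that by (auto simp: c1_eq)
    qed
    ultimately show ?thesis by (rule keq_trans[OF G])
  qed
qed

text \<open>The vertices of disagreement are independent, so the neighbors of such a vertex already
  have their final colors. Each one can be recolored alone, which is a change in two colors.\<close>

lemma keq_independent:
  assumes G: "simple_graph G" and c: "proper G k c" and d: "proper G k d"
    and ind: "\<And>u v. {u, v} \<in> edges G \<Longrightarrow> c u = d u \<or> c v = d v"
  shows "keq G k c d"
  using c ind
proof (induction "card {v \<in> verts G. c v \<noteq> d v}" arbitrary: c rule: less_induct)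
  case less
  have fin: "finite (verts G)" using G by (simp add: simple_graph_def)
  show ?case
  proof (cases "\<exists>v\<in>verts G. c v \<noteq> d v")
    case False
    then show ?thesis using keq_two_colors[OF G less.prems(1) d] by blast
  next
    case True
    then obtain v where v: "v \<in> verts G" "c v \<noteq> d v" by blast
    define c1 where "c1 = c(v := d v)"
    have c1: "proper G k c1"
      unfolding proper_def
    proof (intro conjI ballI allI impI)
      fix w assume "w \<in> verts G"
      then show "c1 w \<in> {1..k}" using less.prems(1) d by (auto simp: c1_def proper_def)
    next
      fix u w assume uw: "{u, w} \<in> edges G"
      then have wu: "{w, u} \<in> edges G" by (simp add: insert_commute)
      show "c1 u \<noteq> c1 w"
        using less.prems(1) d less.prems(2)[OF uw] uw wu v
        unfolding c1_def proper_def by (metis fun_upd_apply)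
    qed
    have "keq G k c c1"
      by (rule keq_two_colors[OF G less.prems(1) c1, of "c v" "d v"]) (auto simp: c1_def)
    moreover have "keq G k c1 d"
    proof (rule less.hyps[OF _ c1])
      have "{w \<in> verts G. c1 w \<noteq> d w} \<subset> {w \<in> verts G. c w \<noteq> d w}"
        using v by (auto simp: c1_def)
      then show "card {w \<in> verts G. c1 w \<noteq> d w} < card {w \<in> verts G. c w \<noteq> d w}"
        using fin by (intro psubset_card_mono) auto
      show "c1 u = d u \<or> c1 w = d w" if "{u, w} \<in> edges G" for u w
        using less.prems(2)[OF that] by (auto simp: c1_def)
    qed
    ultimately show ?thesis by (rule keq_trans[OF G])
  qed
qed

section \<open>Deleting vertices of small degree\<close>

text \<open>An arbitrary relation on a vertex set replaces the graph here, because the arguments are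
  applied later to quotients in which two vertices are identified.\<close>

definition coloring_on :: "'c set \<Rightarrow> ('a \<Rightarrow> 'a \<Rightarrow> bool) \<Rightarrow> 'a set \<Rightarrow> ('a \<Rightarrow> 'c) \<Rightarrow> bool" where
  "coloring_on K R W c \<longleftrightarrow> c ` W \<subseteq> K \<and> (\<forall>u\<in>W. \<forall>v\<in>W. R u v \<longrightarrow> c u \<noteq> c v)"

definition two_color_step ::
    "'c set \<Rightarrow> ('a \<Rightarrow> 'a \<Rightarrow> bool) \<Rightarrow> 'a set \<Rightarrow> ('a \<Rightarrow> 'c) \<Rightarrow> ('a \<Rightarrow> 'c) \<Rightarrow> bool" where
  "two_color_step K R W c d \<longleftrightarrow> coloring_on K R W c \<and> coloring_on K R W d \<and>
     (\<exists>i j. \<forall>v\<in>W. c v = d v \<or> c v \<in> {i, j} \<and> d v \<in> {i, j})"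

definition linked :: "'c set \<Rightarrow> ('a \<Rightarrow> 'a \<Rightarrow> bool) \<Rightarrow> 'a set \<Rightarrow> bool" where
  "linked K R W \<longleftrightarrow> (\<forall>c d. coloring_on K R W c \<longrightarrow> coloring_on K R W d \<longrightarrow>
     (two_color_step K R W)\<^sup>*\<^sup>* c d)"

lemma two_color_stepI:
  assumes "coloring_on K R W c" "coloring_on K R W d"
    and "\<And>v. v \<in> W \<Longrightarrow> c v = d v \<or> c v \<in> {i, j} \<and> d v \<in> {i, j}"
  shows "two_color_step K R W c d"
  unfolding two_color_step_def using assms by blast

lemma coloring_on_mono: "coloring_on K R W c \<Longrightarrow> W' \<subseteq> W \<Longrightarrow> coloring_on K R W' c"
  unfolding coloring_on_def by blast

lemma coloring_on_cong: "(\<And>w. w \<in> W \<Longrightarrow> c w = d w) \<Longrightarrow> coloring_on K R W c \<longleftrightarrow> coloring_on K R W d"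
  unfolding coloring_on_def by (metis image_cong)

lemma coloring_on_insert:
  assumes "symp R" "coloring_on K R (W - {v}) c" "c v \<in> K"
    and "\<not> R v v" "\<And>w. w \<in> W - {v} \<Longrightarrow> R v w \<Longrightarrow> c v \<noteq> c w"
  shows "coloring_on K R W c"
proof -
  have "c a \<noteq> c b" if "a \<in> W" "b \<in> W" "R a b" for a b
  proof (cases "a = v")
    case True then show ?thesis using assms(4,5) that by auto
  next
    case a: False
    show ?thesis
    proof (cases "b = v")
      case True
      then show ?thesis using assms(1,5) that a by (metis DiffI singletonD sympD)
    next
      case False then show ?thesis using assms(2) a that by (auto simp: coloring_on_def)
    qed
  qed
  moreover have "c ` W \<subseteq> K" using assms(2,3) by (auto simp: coloring_on_def)
  ultimately show ?thesis by (auto simp: coloring_on_def)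
qed

text \<open>The deleted vertex \<open>v\<close> either avoids the colors \<open>i\<close>,
  \<open>j\<close>, or can first be moved away from them, or sees every other color. In the last
  case the degree bound leaves at most one neighbor colored from \<open>{i, j}\<close>, and
  \<open>v\<close> can trade colors with it.\<close>

lemma two_color_step_lift:
  assumes R: "symp R" and K: "finite K" and W: "finite W" and v: "v \<in> W"
    and deg: "card {w \<in> W. R v w} < card K"
    and step: "two_color_step K R (W - {v}) c d" and c: "coloring_on K R W c"
  shows "\<exists>d'. (\<forall>w. w \<noteq> v \<longrightarrow> d' w = d w) \<and> coloring_on K R W d' \<and> (two_color_step K R W)\<^sup>*\<^sup>* c d'"
proof -
  have dcol: "coloring_on K R (W - {v}) d" using step by (simp add: two_color_step_def)
  have "\<exists>i j. \<forall>w\<in>W - {v}. c w = d w \<or> c w \<in> {i, j} \<and> d w \<in> {i, j}"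
    using step unfolding two_color_step_def by (elim conjE)
  then obtain i j where "\<forall>w\<in>W - {v}. c w = d w \<or> c w \<in> {i, j} \<and> d w \<in> {i, j}"
    by (elim exE)
  then have ij: "c w = d w \<or> c w \<in> {i, j} \<and> d w \<in> {i, j}" if "w \<in> W - {v}" for w
    using that by (rule bspec)
  have irr: "\<not> R v v" using c v by (auto simp: coloring_on_def)
  have lift: "\<exists>d'. (\<forall>w. w \<noteq> v \<longrightarrow> d' w = d w) \<and> coloring_on K R W d' \<and> two_color_step K R W c' d'"
    if c': "coloring_on K R W c'" "\<And>w. w \<noteq> v \<Longrightarrow> c' w = c w"
      and a: "a \<in> K" "\<And>w. w \<in> W - {v} \<Longrightarrow> R v w \<Longrightarrow> a \<noteq> d w" "c' v = a \<or> c' v \<in> {i, j} \<and> a \<in> {i, j}"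
    for c' a
  proof -
    let ?d = "d(v := a)"
    have "coloring_on K R W ?d"
    proof (rule coloring_on_insert[OF R])
      show "coloring_on K R (W - {v}) ?d"
        using dcol by (subst coloring_on_cong[where d = d]) auto
    qed (use a irr in auto)
    moreover have "c' w = ?d w \<or> c' w \<in> {i, j} \<and> ?d w \<in> {i, j}" if "w \<in> W" for w
      using ij[of w] a(3) c'(2)[of w] that by (cases "w = v") auto
    ultimately have "two_color_step K R W c' ?d" using c'(1) by (intro two_color_stepI)
    then show ?thesis using \<open>coloring_on K R W ?d\<close> by (intro exI[of _ ?d]) simp
  qed
  have cv: "c w \<noteq> c v" if "w \<in> W" "R v w" for w
    using c that v unfolding coloring_on_def by metis
  have cvK: "c v \<in> K" using c v by (auto simp: coloring_on_def)
  show ?thesis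
  proof (cases "c v \<in> {i, j}")
    case False
    then have "\<And>w. w \<in> W - {v} \<Longrightarrow> R v w \<Longrightarrow> c v \<noteq> d w" using ij cv by (metis DiffD1)
    with lift[of c "c v"] c cvK show ?thesis by blast
  next
    case vij: True
    let ?N = "{w \<in> W. R v w}"
    show ?thesis
    proof (cases "\<exists>a\<in>K - {i, j}. a \<notin> c ` ?N")
      case True
      \<comment> \<open>Moving v to a color outside i, j first frees it from the change.\<close>
      then obtain a where a: "a \<in> K" "a \<notin> {i, j}" "a \<notin> c ` ?N" by blast
      let ?c = "c(v := a)"
      have cc: "coloring_on K R W ?c"
      proof (rule coloring_on_insert[OF R])
        show "coloring_on K R (W - {v}) ?c"
          using coloring_on_mono[OF c, of "W - {v}"] by (subst coloring_on_cong[where d = c]) auto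
      qed (use a irr in auto)
      have first: "two_color_step K R W c ?c"
        by (rule two_color_stepI[OF c cc, of "c v" a]) auto
      have nd: "a \<noteq> d w" if "w \<in> W - {v}" "R v w" for w
      proof -
        have "c w \<noteq> a" using a(3) that by blast
        then show ?thesis using ij[OF that(1)] a(2) by metis
      qed
      have "\<exists>d'. (\<forall>w. w \<noteq> v \<longrightarrow> d' w = d w) \<and> coloring_on K R W d' \<and> two_color_step K R W ?c d'"
        by (rule lift[OF cc _ a(1) nd]) simp_all
      then obtain d' where "\<forall>w. w \<noteq> v \<longrightarrow> d' w = d w" "coloring_on K R W d'"
        "two_color_step K R W ?c d'" by (elim exE conjE)
      moreover from this(3) have "(two_color_step K R W)\<^sup>*\<^sup>* c d'"
        by (intro converse_rtranclp_into_rtranclp[of _ c ?c] first r_into_rtranclp)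
      ultimately show ?thesis by blast
    next
      case False
      then have sub: "K - {i, j} \<subseteq> c ` {w \<in> ?N. c w \<notin> {i, j}}" by blast
      have ijK: "c w \<in> K" if "w \<in> W" for w using c that by (auto simp: coloring_on_def)
      have few: "card {w \<in> ?N. c w \<in> {i, j}} \<le> 1"
      proof -
        have "card (K - {i, j}) \<le> card {w \<in> ?N. c w \<notin> {i, j}}"
          using W by (intro surj_card_le[OF _ sub]) auto
        moreover have "card ?N = card {w \<in> ?N. c w \<in> {i, j}} + card {w \<in> ?N. c w \<notin> {i, j}}"
          using W by (subst card_Un_disjoint[symmetric]) (auto intro: arg_cong[where f = card])
        moreover have "card K \<le> card (K - {i, j}) + 2"
        proof -
          have "card K \<le> card ((K - {i, j}) \<union> {i, j})" using K by (intro card_mono) auto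
          also have "\<dots> \<le> card (K - {i, j}) + card {i, j}" by (rule card_Un_le)
          also have "card {i, j} \<le> 2" by (simp add: card_insert_if)
          finally show ?thesis by simp
        qed
        ultimately show ?thesis using deg by linarith
      qed
      let ?M = "{w \<in> ?N. c w \<in> {i, j}}"
      have Mv: "w \<noteq> v" if "w \<in> ?M" for w using irr that by auto
      \<comment> \<open>The only neighbor of \<open>v\<close> that can interfere is the one in
        \<open>?M\<close>; \<open>v\<close> changes its color exactly when that neighbor takes
        it.\<close>
      define a where "a = (if \<exists>w\<in>?M. d w = c v then (if c v = i then j else i) else c v)"
      have aK: "a \<in> K"
      proof (cases "\<exists>w\<in>?M. d w = c v")
        case True
        then obtain w where w: "w \<in> ?M" by blast
        then have "c w \<in> K" "c w \<in> {i, j}" "c w \<noteq> c v" using ijK cv by auto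
        then have "c w = a" using vij True by (auto simp: a_def)
        then show ?thesis using \<open>c w \<in> K\<close> by simp
      qed (use cvK in \<open>auto simp: a_def\<close>)
      have "a \<noteq> d w" if w: "w \<in> W - {v}" "R v w" for w
      proof (cases "c w \<in> {i, j}")
        case False
        then have "d w \<notin> {i, j}" using ij[OF w(1)] by auto
        then show ?thesis using vij by (auto simp: a_def)
      next
        case True
        then have "w \<in> ?M" using w by auto
        then have "w' = w" if "w' \<in> ?M" for w'
          using few that W card_le_Suc0_iff_eq[of ?M] by auto
        moreover have "i \<noteq> j" using True vij cv[of w] w by auto
        ultimately show ?thesis
          using \<open>w \<in> ?M\<close> vij ij[OF w(1)] unfolding a_def by (smt (verit) insertE singletonD)
      qed
      moreover have "c v = a \<or> c v \<in> {i, j} \<and> a \<in> {i, j}" using vij by (auto simp: a_def)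
      ultimately show ?thesis using lift[of c a] c aK by blast
    qed
  qed
qed

lemma linked_delete:
  assumes R: "symp R" and K: "finite K" and W: "finite W" and v: "v \<in> W"
    and deg: "card {w \<in> W. R v w} < card K" and link: "linked K R (W - {v})"
  shows "linked K R W"
  unfolding linked_def
proof (intro allI impI)
  fix c d assume c: "coloring_on K R W c" and d: "coloring_on K R W d"
  have "(two_color_step K R (W - {v}))\<^sup>*\<^sup>* c d"
    using link coloring_on_mono[OF c, of "W - {v}"] coloring_on_mono[OF d, of "W - {v}"]
    by (auto simp: linked_def)
  then have "\<exists>d'. (\<forall>w. w \<noteq> v \<longrightarrow> d' w = d w) \<and> coloring_on K R W d' \<and> (two_color_step K R W)\<^sup>*\<^sup>* c d'"
  proof (induction rule: rtranclp_induct)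
    case base then show ?case using c by blast
  next
    case (step y z)
    then obtain y' where y': "\<forall>w. w \<noteq> v \<longrightarrow> y' w = y w" "coloring_on K R W y'"
      "(two_color_step K R W)\<^sup>*\<^sup>* c y'" by blast
    have "two_color_step K R (W - {v}) y' z"
      using step(2) y'(1) coloring_on_mono[OF y'(2), of "W - {v}"]
      unfolding two_color_step_def by (metis DiffD2 Diff_subset singletonI)
    from two_color_step_lift[OF R K W v deg this y'(2)] show ?case
      using y'(3) by (meson rtranclp_trans)
  qed
  then obtain d' where d': "\<forall>w. w \<noteq> v \<longrightarrow> d' w = d w" "coloring_on K R W d'"
    "(two_color_step K R W)\<^sup>*\<^sup>* c d'" by blast
  \<comment> \<open>The lifted sequence ends correctly everywhere except possibly at
    \<open>v\<close>, which one more step repairs.\<close>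
  have "two_color_step K R W d' d"
    by (rule two_color_stepI[OF d'(2) d, of "d' v" "d v"]) (use d'(1) in auto)
  then show "(two_color_step K R W)\<^sup>*\<^sup>* c d" using d'(3) by (meson rtranclp.rtrancl_into_rtrancl)
qed

text \<open>Deleting vertices of degree below \<open>card K\<close> as long as possible ends with
  the empty set or with a core in which every degree is at least \<open>card K\<close>; only cores
  need an argument.\<close>

lemma linked_degenerate:
  assumes R: "symp R" and K: "finite K" and W: "finite W"
    and core: "\<And>W'. W' \<subseteq> W \<Longrightarrow> W' \<noteq> {} \<Longrightarrow> \<forall>v\<in>W'. card K \<le> card {w \<in> W'. R v w} \<Longrightarrow> linked K R W'"
  shows "linked K R W"
proof -
  have "linked K R W'" if "W' \<subseteq> W" for W'
    using finite_subset[OF that W] that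
  proof (induction W' rule: finite_psubset_induct)
    case (psubset A)
    show ?case
    proof (cases "A = {} \<or> (\<forall>v\<in>A. card K \<le> card {w \<in> A. R v w})")
      case True
      then show ?thesis
      proof
        assume "A = {}"
        then show ?thesis by (auto simp: linked_def intro!: r_into_rtranclp two_color_stepI)
      next
        assume h: "\<forall>v\<in>A. card K \<le> card {w \<in> A. R v w}"
        show ?thesis
        proof (cases "A = {}")
          case True
          then show ?thesis by (auto simp: linked_def intro!: r_into_rtranclp two_color_stepI)
        qed (use core[OF psubset.prems _ h] in simp)
      qed
    next
      case False
      then obtain v where v: "v \<in> A" "card {w \<in> A. R v w} < card K" by (auto simp: not_le)
      have "linked K R (A - {v})" using psubset v by blast
      then show ?thesis using linked_delete[OF R K psubset.hyps(1) v] by blast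
    qed
  qed
  then show ?thesis by blast
qed

section \<open>Graphs with few edges\<close>

text \<open>Handshake count: each edge is met by at most two ordered pairs of elements of
  \<open>A\<close>.\<close>

lemma sum_degrees_le:
  assumes F: "finite F" and A: "finite A" and two: "\<And>e. e \<in> F \<Longrightarrow> card e = 2"
  shows "(\<Sum>a\<in>A. card {b \<in> A. {a, b} \<in> F}) \<le> 2 * card F"
proof -
  have "(\<Sum>a\<in>A. card {b \<in> A. {a, b} \<in> F}) = card (SIGMA a:A. {b \<in> A. {a, b} \<in> F})"
    using A by (intro card_SigmaI[symmetric]) auto
  also have "\<dots> \<le> card (\<Union>e\<in>F. {(a, b). {a, b} = e})"
  proof (intro card_mono finite_UN_I F)
    fix e assume "e \<in> F"
    then have "finite e" using two by (metis card.infinite zero_neq_numeral)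
    then have "finite (e \<times> e)" by simp
    moreover have "{(a, b). {a, b} = e} \<subseteq> e \<times> e" by blast
    ultimately show "finite {(a, b). {a, b} = e}" by (rule rev_finite_subset)
  next
    show "(SIGMA a:A. {b \<in> A. {a, b} \<in> F}) \<subseteq> (\<Union>e\<in>F. {(a, b). {a, b} = e})" by blast
  qed
  also have "\<dots> \<le> (\<Sum>e\<in>F. card {(a, b). {a, b} = e})" by (rule card_UN_le[OF F])
  also have "\<dots> \<le> (\<Sum>e\<in>F. 2)"
  proof (rule sum_mono)
    fix e assume "e \<in> F"
    then obtain a b where e: "e = {a, b}" using two by (meson card_2_iff)
    have "{(x, y). {x, y} = e} \<subseteq> {(a, b), (b, a)}" unfolding e doubleton_eq_iff by blast
    then have "card {(x, y). {x, y} = e} \<le> card {(a, b), (b, a)}"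
      by (rule card_mono[rotated]) simp
    also have "\<dots> \<le> 2" using card_length[of "[(a, b), (b, a)]"] by simp
    finally show "card {(x, y). {x, y} = e} \<le> 2" .
  qed
  finally show ?thesis by simp
qed

text \<open>The hub \<open>q\<close> takes one color and the rim \<open>a\<close>, \<open>b\<close>,
  \<open>d\<close>, \<open>c\<close> alternates between the other two. Exchanging two colors in
  \<open>f\<close> brings the hub to its value in \<open>g\<close>; then at most an exchange of the
  two rim colors remains.\<close>

lemma linked_wheel4:
  assumes W: "W = {q, a, b, c, d}"
    and R: "R q a" "R q b" "R q c" "R q d" "R a b" "R a c" "R d b" "R d c"
  shows "linked {1, 2, 3::nat} R W"
  unfolding linked_def
proof (intro allI impI)
  fix f g assume f: "coloring_on {1, 2, 3::nat} R W f" and g: "coloring_on {1, 2, 3::nat} R W g"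
  define h where "h = (\<lambda>v. if f v = f q then g q else if f v = g q then f q else f v)"
  have col: "e q \<in> {1, 2, 3}" "e a \<in> {1, 2, 3} - {e q}" "e d = e a"
    "e b \<in> {1, 2, 3} - {e q, e a}" "e c = e b" if "coloring_on {1, 2, 3::nat} R W e" for e
  proof -
    have ne: "e x \<noteq> e y" if "R x y" "x \<in> W" "y \<in> W" for x y
      using \<open>coloring_on _ R W e\<close> that unfolding coloring_on_def by metis
    have K: "e x = 1 \<or> e x = 2 \<or> e x = 3" if "x \<in> W" for x
      using \<open>coloring_on _ R W e\<close> that unfolding coloring_on_def by blast
    have Ws: "q \<in> W" "a \<in> W" "b \<in> W" "c \<in> W" "d \<in> W" using W by blast+
    note ks = Ws[THEN K]
    note ns = ne[OF R(1)] ne[OF R(2)] ne[OF R(3)] ne[OF R(4)] ne[OF R(5)] ne[OF R(6)]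
        ne[OF R(7)] ne[OF R(8)]
    have "e q \<noteq> e a" "e q \<noteq> e b" "e q \<noteq> e c" "e q \<noteq> e d"
      "e a \<noteq> e b" "e a \<noteq> e c" "e d \<noteq> e b" "e d \<noteq> e c"
      using ns Ws by blast+
    note ns = this
    show "e q \<in> {1, 2, 3}" using ks(1) by simp
    show "e a \<in> {1, 2, 3} - {e q}" using ks(2) ns(1) by simp
    show "e b \<in> {1, 2, 3} - {e q, e a}" using ks(3) ns(2,5) by simp
    show "e d = e a" using ks(1,2,3,5) ns(1,2,4,5,7) by (smt (verit))
    show "e c = e b" using ks(1,2,3,4) ns(1,2,3,5,6) by (smt (verit))
  qed
  have h: "coloring_on {1, 2, 3} R W h"
  proof -
    have "h v \<noteq> h w" if "v \<in> W" "w \<in> W" "R v w" for v w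
    proof -
      have "f v \<noteq> f w" using f that unfolding coloring_on_def by metis
      then show ?thesis unfolding h_def by metis
    qed
    moreover have "h v \<in> {1, 2, 3}" if "v \<in> W" for v
    proof -
      have "f v \<in> {1, 2, 3}" using f that unfolding coloring_on_def by blast
      then show ?thesis using col(1)[OF f] col(1)[OF g] unfolding h_def by presburger
    qed
    ultimately show ?thesis unfolding coloring_on_def by blast
  qed
  have hq: "h q = g q" by (simp add: h_def)
  have cover: "x = h q \<or> x = h a \<or> x = h b" if "x \<in> {1, 2, 3}" for x
    using col(1,2,4)[OF h] that by (smt (verit) DiffE insert_iff empty_iff)
  have "two_color_step {1, 2, 3} R W f h"
    by (rule two_color_stepI[OF f h, of "f q" "g q"]) (auto simp: h_def)
  moreover have "two_color_step {1, 2, 3} R W h g"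
  proof (rule two_color_stepI[OF h g, of "h a" "h b"])
    fix v assume "v \<in> W"
    then consider "v = q" | "v = a \<or> v = d" | "v = b \<or> v = c" using W by blast
    then show "h v = g v \<or> h v \<in> {h a, h b} \<and> g v \<in> {h a, h b}"
    proof cases
      case 1 then show ?thesis using hq by simp
    next
      case 2
      then have "h v = h a" "g v = g a" using col(3)[OF h] col(3)[OF g] by metis+
      moreover have "g a = h a \<or> g a = h b" using cover[of "g a"] col(2)[OF g] hq by (metis DiffD1 DiffD2 singletonI)
      ultimately show ?thesis by (metis insertI1 insertI2)
    next
      case 3
      then have "h v = h b" "g v = g b" using col(5)[OF h] col(5)[OF g] by metis+
      moreover have "g b = h a \<or> g b = h b" using cover[of "g b"] col(4)[OF g] hq by (metis DiffD1 DiffD2 insertI1)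
      ultimately show ?thesis by (metis insertI1 insertI2)
    qed
  qed
  ultimately show "(two_color_step {1, 2, 3} R W)\<^sup>*\<^sup>* f g"
    by (meson converse_rtranclp_into_rtranclp r_into_rtranclp)
qed

text \<open>A vertex set inside \<open>S \<union> X\<close> without vertices of degree below 3 is by edge counting a
  complete graph on four vertices, which is not 3-colorable, or a wheel with four spokes.\<close>

lemma linked_few_edges:
  assumes R: "symp R" and S: "finite S" and F: "finite F" and two: "\<And>e. e \<in> F \<Longrightarrow> card e = 2"
    and RF: "\<And>a b. a \<in> S \<Longrightarrow> b \<in> S \<Longrightarrow> R a b \<Longrightarrow> {a, b} \<in> F"
    and X: "X \<subseteq> {q}" "S \<inter> X = {}" and few: "card F + card X \<le> 5"
    and f: "coloring_on {1, 2, 3::nat} R (S \<union> X) f"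
  shows "linked {1, 2, 3::nat} R (S \<union> X)"
proof (rule linked_degenerate[OF R])
  show "finite (S \<union> X)" using S X by (auto intro: finite_subset)
  fix W assume W: "W \<subseteq> S \<union> X" "W \<noteq> {}" "\<forall>v\<in>W. card {1, 2, 3::nat} \<le> card {w \<in> W. R v w}"
  have "card {1, 2, 3::nat} = 3" by simp
  then have deg: "3 \<le> card {w \<in> W. R v w}" if "v \<in> W" for v using W(3) that by metis
  have finW: "finite W" using W(1) S X by (auto intro: finite_subset)
  have irr: "\<not> R v v" if "v \<in> W" for v
    using f W(1) that unfolding coloring_on_def by blast
  define A where "A = W \<inter> S"
  have finA: "finite A" using S by (simp add: A_def)
  let ?N = "\<lambda>a. {b \<in> A. {a, b} \<in> F}"
  have N: "?N a \<subseteq> A - {a}" for a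
  proof -
    have "{a} \<notin> F" using two[of "{a}"] by auto
    then show ?thesis by auto
  qed
  have sum: "(\<Sum>a\<in>A. card (?N a)) \<le> 2 * card F" by (rule sum_degrees_le[OF F finA two])
  have WA: "W = A \<union> (W \<inter> X)" using W(1) by (auto simp: A_def)
  have nbrs: "{w \<in> W. R a w} \<subseteq> ?N a \<union> (W \<inter> X)" if "a \<in> A" for a
    using that RF W(1) by (auto simp: A_def)
  have degA: "3 \<le> card (?N a) + card (W \<inter> X)" if "a \<in> A" for a
  proof -
    have "3 \<le> card {w \<in> W. R a w}" using deg that by (simp add: A_def)
    also have "\<dots> \<le> card (?N a \<union> (W \<inter> X))" using nbrs[OF that] finA finW by (intro card_mono) auto
    also have "\<dots> \<le> card (?N a) + card (W \<inter> X)" by (rule card_Un_le)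
    finally show ?thesis .
  qed
  have N_card: "card (?N a) \<le> card A - 1" if "a \<in> A" for a
    using card_mono[OF _ N[of a]] finA that by simp
  show "linked {1, 2, 3::nat} R W"
  proof (cases "W \<inter> X = {}")
    case True
    then obtain a where a: "a \<in> A" using W(2) WA by auto
    \<comment> \<open>Four vertices of degree three inside \<open>S\<close> need a degree sum of 12,
      while five edges give at most 10.\<close>
    then have "4 \<le> card A" using N_card[OF a] degA[OF a] True by simp
    moreover have "card A * 3 \<le> (\<Sum>a\<in>A. card (?N a))"
      using sum_mono[of A "\<lambda>_. 3" "\<lambda>a. card (?N a)"] degA True by simp
    ultimately show ?thesis using sum few by linarith
  next
    case False
    then have q: "W \<inter> X = {q}" "X = {q}" "q \<in> W" using X by auto
    have Wq: "W = insert q A" "q \<notin> A" using WA q X by (auto simp: A_def)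
    have "{w \<in> W. R q w} \<subseteq> A" using Wq irr q(3) by auto
    then have "3 \<le> card A" using deg[OF q(3)] card_mono[OF finA] order_trans by blast
    moreover have two_le: "2 \<le> card (?N a)" if "a \<in> A" for a using degA[OF that] q(1) by simp
    have "card A * 2 \<le> (\<Sum>a\<in>A. card (?N a))"
      using sum_mono[of A "\<lambda>_. 2" "\<lambda>a. card (?N a)"] two_le by simp
    \<comment> \<open>The vertex \<open>q\<close> uses one unit of the bound five, so at most four
      edges remain inside \<open>S\<close> and the degree sum is at most 8.\<close>
    then have "card A \<le> 4" using sum few q(2) by simp
    ultimately consider "card A = 3" | "card A = 4" by linarith
    then have nb: "card (?N a) = 2" if "a \<in> A" for a
    proof cases
      case 1 then show ?thesis using N_card[OF that] two_le[OF that] by simp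
    next
      \<comment> \<open>Four vertices of degree at least two already use the whole degree sum 8, so
        each degree is exactly two.\<close>
      case 2
      have "(\<Sum>b\<in>A. card (?N b)) = card (?N a) + (\<Sum>b\<in>A - {a}. card (?N b))"
        using finA that by (rule sum.remove)
      moreover have "card (A - {a}) * 2 \<le> (\<Sum>b\<in>A - {a}. card (?N b))"
        using sum_mono[of "A - {a}" "\<lambda>_. 2" "\<lambda>a. card (?N a)"] two_le by simp
      ultimately show ?thesis using sum few q(2) two_le[OF that] 2 that finA by simp
    qed
    have full: "{w \<in> W. R a w} = insert q (?N a)" if "a \<in> A" for a
    proof (rule card_seteq)
      show "finite (insert q (?N a))" using finA by simp
      show "{w \<in> W. R a w} \<subseteq> insert q (?N a)" using nbrs[OF that] q by auto
      show "card (insert q (?N a)) \<le> card {w \<in> W. R a w}"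
      proof -
        have "card (insert q (?N a)) = 3" using nb[OF that] Wq(2) finA by simp
        then show ?thesis using deg[of a] that by (simp add: A_def)
      qed
    qed
    have Rq: "R q a" if "a \<in> A" for a using full[OF that] sympD[OF R] by blast
    have RN: "R a b" if "a \<in> A" "b \<in> ?N a" for a b using full[OF that(1)] that(2) by blast
    have N_sym: "a \<in> ?N b" if "a \<in> A" "b \<in> ?N a" for a b using that by (auto simp: insert_commute)
    from \<open>3 \<le> card A\<close> \<open>card A \<le> 4\<close> consider "card A = 3" | "card A = 4" by linarith
    then show ?thesis
    proof cases
      case 1
      have all: "?N a = A - {a}" if "a \<in> A" for a
        using card_seteq[OF _ N[of a]] nb[OF that] 1 that finA by simp
      have "R v w" if vw: "v \<in> W" "w \<in> W" "v \<noteq> w" for v w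
      proof -
        consider "v = q" "w \<in> A" | "w = q" "v \<in> A" | "v \<in> A" "w \<in> A" using vw Wq by blast
        then show ?thesis
        proof cases
          case 1 then show ?thesis using Rq by simp
        next
          case 2 then show ?thesis using Rq sympD[OF R] by simp
        next
          case 3 then show ?thesis using RN[of v w] all[of v] vw by blast
        qed
      qed
      \<comment> \<open>A complete graph on four vertices would force \<open>f\<close> to use four
        colors.\<close>
      then have "inj_on f W" using f W(1) unfolding coloring_on_def inj_on_def by (metis subsetD)
      moreover have "f ` W \<subseteq> {1, 2, 3}" using f W(1) unfolding coloring_on_def by blast
      ultimately have "card W \<le> card {1, 2, 3::nat}" by (intro card_inj_on_le) auto
      then show ?thesis using Wq 1 finA by simp
    next
      case 2
      then obtain a where a: "a \<in> A" by fastforce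
      \<comment> \<open>Four vertices of degree two form a 4-cycle, the rim of the wheel;
        \<open>d\<close> will be the vertex opposite to \<open>a\<close>.\<close>
      obtain b c where bc: "?N a = {b, c}" "b \<noteq> c" using nb[OF a] by (meson card_2_iff)
      have bcA: "b \<in> A" "c \<in> A" "b \<noteq> a" "c \<noteq> a" using bc N[of a] by blast+
      have "card (A - {a, b, c}) = 1" using 2 a bcA bc(2) finA by (simp add: card_Diff_subset)
      then obtain d where d: "A - {a, b, c} = {d}" by (meson card_1_singletonE)
      then have dA: "d \<in> A" "d \<noteq> a" "d \<noteq> b" "d \<noteq> c" by blast+
      have "a \<notin> ?N d" using N_sym[of d a] dA bc a by blast
      then have "?N d \<subseteq> {b, c}" using N[of d] d by blast
      moreover have "card (?N d) = card {b, c}" using nb[OF dA(1)] bc(2) by simp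
      ultimately have Nd: "?N d = {b, c}" by (intro card_subset_eq) auto
      have "W = {q, a, b, c, d}" using Wq d a bcA dA by blast
      then show ?thesis
        by (rule linked_wheel4) (use Rq RN a bc Nd bcA dA in blast)+
    qed
  qed
qed simp

section \<open>Reduction to three colors on one side\<close>

text \<open>The bound two inside \<open>T\<close> is no loss of generality: of at most five edges,
  one side contains at most two, and the sides can be interchanged.\<close>

locale near_bipartite =
  fixes G :: "'a ugraph" and S T :: "'a set"
  assumes simple: "simple_graph G" and verts_eq: "verts G = S \<union> T" and disj: "S \<inter> T = {}"
    and few: "card {e \<in> edges G. e \<subseteq> S} + card {e \<in> edges G. e \<subseteq> T} \<le> 5"
    and fewT: "card {e \<in> edges G. e \<subseteq> T} \<le> 2"
begin

abbreviation E :: "'a \<Rightarrow> 'a \<Rightarrow> bool" where "E u v \<equiv> {u, v} \<in> edges G"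

abbreviation eqv :: "('a \<Rightarrow> nat) \<Rightarrow> ('a \<Rightarrow> nat) \<Rightarrow> bool" where "eqv \<equiv> keq G 4"

definition F :: "'a set \<Rightarrow> 'a set set" where "F A = {e \<in> edges G. e \<subseteq> A}"

lemma E_sym: "E u v \<Longrightarrow> E v u"
  by (simp add: insert_commute)

lemma E_irrefl: "\<not> E u u"
  using simple by (auto simp: simple_graph_def)

lemma E_verts: "E u v \<Longrightarrow> u \<in> S \<union> T \<and> v \<in> S \<union> T"
  using simple verts_eq by (auto simp: simple_graph_def)

lemma finite_sides: "finite S" "finite T"
  using simple verts_eq by (auto simp: simple_graph_def)

lemma finite_F: "finite (F A)"
proof -
  have "F A \<subseteq> Pow (S \<union> T)" using simple verts_eq by (auto simp: F_def simple_graph_def)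
  then show ?thesis using finite_sides by (meson finite_Pow_iff finite_UnI finite_subset)
qed

lemma card_edge: "e \<in> F A \<Longrightarrow> card e = 2"
  using simple by (simp add: F_def simple_graph_def)

lemma F_iff: "{u, v} \<in> F A \<longleftrightarrow> u \<in> A \<and> v \<in> A \<and> E u v"
  by (auto simp: F_def)

lemma F_few: "card (F S) + card (F T) \<le> 5" "card (F T) \<le> 2"
  using few fewT by (auto simp: F_def)

lemma proper_range: "proper G 4 c \<Longrightarrow> v \<in> S \<union> T \<Longrightarrow> c v \<in> {1..4}"
  by (simp add: proper_def verts_eq)

lemma proper_neq: "proper G 4 c \<Longrightarrow> E u v \<Longrightarrow> c u \<noteq> c v"
  by (simp add: proper_def)

lemma properI:
  assumes "\<And>v. v \<in> S \<union> T \<Longrightarrow> c v \<in> {1..4}"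
    and SS: "\<And>u v. u \<in> S \<Longrightarrow> v \<in> S \<Longrightarrow> E u v \<Longrightarrow> c u \<noteq> c v"
    and TT: "\<And>u v. u \<in> T \<Longrightarrow> v \<in> T \<Longrightarrow> E u v \<Longrightarrow> c u \<noteq> c v"
    and ST: "\<And>u v. u \<in> S \<Longrightarrow> v \<in> T \<Longrightarrow> E u v \<Longrightarrow> c u \<noteq> c v"
  shows "proper G 4 c"
proof -
  have "c u \<noteq> c v" if "E u v" for u v
    using E_verts[OF that] SS TT ST[of u v] ST[of v u] that E_sym[OF that] by fastforce
  then show ?thesis using assms(1) by (simp add: proper_def verts_eq)
qed

lemma eqv_refl: "proper G 4 c \<Longrightarrow> eqv c c"
  and eqv_sym: "eqv c d \<Longrightarrow> eqv d c"
  and eqv_trans [trans]: "eqv c d \<Longrightarrow> eqv d e \<Longrightarrow> eqv c e"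
  and eqv_proper: "eqv c d \<Longrightarrow> proper G 4 c \<and> proper G 4 d"
  using keq_refl[OF simple] keq_sym[OF simple] keq_trans[OF simple] keq_proper[OF simple] by blast+

lemma eqv_two_colors:
  assumes "proper G 4 c" "proper G 4 d"
    and "\<And>v. v \<in> S \<union> T \<Longrightarrow> c v = d v \<or> c v \<in> {i, j} \<and> d v \<in> {i, j}"
  shows "eqv c d"
  by (rule keq_two_colors[OF simple assms(1,2)]) (rule assms(3), simp add: verts_eq)

lemma eqv_independent:
  assumes "proper G 4 c" "proper G 4 d" and "\<And>u v. E u v \<Longrightarrow> c u = d u \<or> c v = d v"
  shows "eqv c d"
  by (rule keq_independent[OF simple assms(1,2)]) (rule assms(3))

lemma two_colors_free:
  assumes c: "proper G 4 c"
  obtains i j where "i \<in> {1..4}" "j \<in> {1..4}" "i \<noteq> j"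
    "\<And>u v. E u v \<Longrightarrow> u \<in> S \<and> v \<in> S \<or> u \<in> T \<and> v \<in> T \<Longrightarrow> {c u, c v} \<noteq> {i, j}"
proof -
  let ?P = "{{1, 2}, {1, 3}, {1, 4}, {2, 3}, {2, 4}, {3, 4 :: nat}}"
  have "card ?P = 6" by (simp add: doubleton_eq_iff)
  moreover have "card ((`) c ` (F S \<union> F T)) \<le> 5"
    using card_image_le[of "F S \<union> F T" "(`) c"] card_Un_le[of "F S" "F T"] F_few(1) finite_F by simp
  ultimately have "\<not> ?P \<subseteq> (`) c ` (F S \<union> F T)"
    using card_mono[of "(`) c ` (F S \<union> F T)" ?P] finite_F by fastforce
  then obtain p where p: "p \<in> ?P" "p \<notin> (`) c ` (F S \<union> F T)" by blast
  then obtain i j where ij: "p = {i, j}" "i \<in> {1..4}" "j \<in> {1..4}" "i \<noteq> j" by fastforce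
  show ?thesis
  proof (rule that[OF ij(2-4)])
    fix u v assume "E u v" "u \<in> S \<and> v \<in> S \<or> u \<in> T \<and> v \<in> T"
    then have "{u, v} \<in> F S \<union> F T" by (auto simp: F_iff)
    then have "c ` {u, v} \<noteq> p" using p(2) by blast
    then show "{c u, c v} \<noteq> {i, j}" using ij(1) by simp
  qed
qed

section \<open>Concentrating color 4 on an independent part of T\<close>

lemma recolor_independent:
  assumes c: "proper G 4 c" and S4: "\<And>v. v \<in> S \<Longrightarrow> c v \<noteq> 4"
    and I: "I \<subseteq> T" "\<And>t. t \<in> T \<Longrightarrow> c t = 4 \<Longrightarrow> t \<in> I"
    and ind: "\<And>t t'. t \<in> I \<Longrightarrow> t' \<in> I \<Longrightarrow> \<not> E t t'"
  defines "d \<equiv> \<lambda>v. if v \<in> I then 4 else c v"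
  shows "proper G 4 d" "eqv c d"
proof -
  show d: "proper G 4 d"
  proof (rule properI)
    fix v assume "v \<in> S \<union> T" then show "d v \<in> {1..4}"
      using proper_range[OF c] by (simp add: d_def)
  next
    fix u v assume "u \<in> S" "v \<in> S" "E u v" then show "d u \<noteq> d v"
      using proper_neq[OF c] I(1) disj by (auto simp: d_def)
  next
    fix u v assume "u \<in> T" "v \<in> T" "E u v" then show "d u \<noteq> d v"
      using proper_neq[OF c, of u v] I(2)[of u] I(2)[of v] ind by (auto simp: d_def)
  next
    fix u v assume "u \<in> S" "v \<in> T" "E u v" then show "d u \<noteq> d v"
      using proper_neq[OF c, of u v] I(1) disj S4 by (auto simp: d_def)
  qed
  show "eqv c d"
    by (rule eqv_independent[OF c d]) (use ind in \<open>auto simp: d_def\<close>)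
qed

text \<open>The complement \<open>T - Q\<close> is a maximal independent subset of \<open>T\<close>;
  the last conjunct expresses maximality.\<close>

definition admissible :: "'a set \<Rightarrow> bool" where
  "admissible Q \<longleftrightarrow> Q \<subseteq> T \<and> (\<forall>t\<in>T - Q. \<forall>t'\<in>T - Q. \<not> E t t') \<and> (\<forall>q\<in>Q. \<exists>t\<in>T - Q. E q t)"

definition clean :: "'a set \<Rightarrow> ('a \<Rightarrow> nat) \<Rightarrow> bool" where
  "clean Q c \<longleftrightarrow> proper G 4 c \<and> (\<forall>v\<in>S \<union> Q. c v \<in> {1, 2, 3}) \<and> (\<forall>v\<in>T - Q. c v = 4)"

lemma clean_proper: "clean Q c \<Longrightarrow> proper G 4 c"
  and clean_range: "clean Q c \<Longrightarrow> v \<in> S \<union> Q \<Longrightarrow> c v \<in> {1, 2, 3}"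
  and clean_four: "clean Q c \<Longrightarrow> v \<in> T - Q \<Longrightarrow> c v = 4"
  by (auto simp: clean_def)

lemma eqv_clean:
  assumes c: "proper G 4 c"
  obtains Q d where "admissible Q" "clean Q d" "eqv c d"
proof -
  obtain i j where ij: "i \<in> {1..4}" "j \<in> {1..4}" "i \<noteq> j"
    and free: "\<And>u v. E u v \<Longrightarrow> u \<in> S \<and> v \<in> S \<or> u \<in> T \<and> v \<in> T \<Longrightarrow> {c u, c v} \<noteq> {i, j}"
    using two_colors_free[OF c] by blast
  \<comment> \<open>Since no edge inside a side carries both colors \<open>i\<close> and
    \<open>j\<close>, giving \<open>i\<close> to the \<open>S\<close>-part and \<open>j\<close> to
    the \<open>T\<close>-part of these two classes makes no edge monochromatic.\<close>
  define c1 where "c1 = (\<lambda>v. if c v \<in> {i, j} then if v \<in> S then i else j else c v)"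
  have c1: "proper G 4 c1"
  proof (rule properI)
    fix v assume "v \<in> S \<union> T" then show "c1 v \<in> {1..4}"
      using proper_range[OF c] ij by (simp add: c1_def)
  next
    fix u v assume "u \<in> S" "v \<in> S" "E u v" then show "c1 u \<noteq> c1 v"
      using proper_neq[OF c, of u v] free[of u v] by (auto simp: c1_def)
  next
    fix u v assume "u \<in> T" "v \<in> T" "E u v" then show "c1 u \<noteq> c1 v"
      using proper_neq[OF c, of u v] free[of u v] disj by (auto simp: c1_def)
  next
    fix u v assume "u \<in> S" "v \<in> T" "E u v" then show "c1 u \<noteq> c1 v"
      using proper_neq[OF c, of u v] disj ij(3) by (auto simp: c1_def)
  qed
  have e1: "eqv c c1"
    by (rule eqv_two_colors[OF c c1, of i j]) (auto simp: c1_def)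
  have S1: "c1 v \<noteq> j" if "v \<in> S" for v using that ij(3) by (auto simp: c1_def)
  \<comment> \<open>A global exchange of \<open>j\<close> and 4 makes 4 the color that is absent
    from \<open>S\<close>.\<close>
  define c2 where "c2 = (\<lambda>v. if c1 v = j then 4 else if c1 v = 4 then j else c1 v)"
  have c2: "proper G 4 c2"
    unfolding proper_def
  proof (intro conjI ballI allI impI)
    fix v assume "v \<in> verts G" then show "c2 v \<in> {1..4}"
      using c1 ij(2) by (auto simp: proper_def c2_def)
  next
    fix u v assume "E u v"
    then have "c1 u \<noteq> c1 v" by (rule proper_neq[OF c1])
    then show "c2 u \<noteq> c2 v" unfolding c2_def by metis
  qed
  have e2: "eqv c1 c2"
    by (rule eqv_two_colors[OF c1 c2, of j 4]) (auto simp: c2_def)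
  have S2: "c2 v \<noteq> 4" if "v \<in> S" for v using S1[OF that] by (auto simp: c2_def)
  let ?\<I> = "{I. {t \<in> T. c2 t = 4} \<subseteq> I \<and> I \<subseteq> T \<and> (\<forall>t\<in>I. \<forall>t'\<in>I. \<not> E t t')}"
  have mem: "{t \<in> T. c2 t = 4} \<in> ?\<I>"
  proof -
    have "\<not> E t t'" if "c2 t = 4" "c2 t' = 4" for t t' using proper_neq[OF c2, of t t'] that by metis
    then show ?thesis by blast
  qed
  have "?\<I> \<subseteq> Pow T" by blast
  then have "finite ?\<I>" using finite_sides(2) by (rule finite_subset[OF _ iffD2[OF finite_Pow_iff]])
  from finite_has_maximal2[OF this mem]
  obtain I where I: "I \<in> ?\<I>" and max: "\<forall>J\<in>?\<I>. I \<subseteq> J \<longrightarrow> I = J" by (elim bexE conjE)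
  define d where "d = (\<lambda>v. if v \<in> I then 4 else c2 v)"
  have d: "proper G 4 d" "eqv c2 d"
    unfolding d_def by (rule recolor_independent[OF c2 S2]; use I in blast)+
  have "clean (T - I) d"
    unfolding clean_def
  proof (intro conjI ballI d(1))
    fix v assume v: "v \<in> S \<union> (T - I)"
    then have "v \<notin> I" using I disj by blast
    moreover have "c2 v \<noteq> 4" using v S2 I by blast
    moreover have "c2 v \<in> {1..4}" using v by (intro proper_range[OF c2]) auto
    ultimately show "d v \<in> {1, 2, 3}" by (auto simp: d_def)
  qed (auto simp: d_def)
  moreover have "admissible (T - I)"
    unfolding admissible_def
  proof (intro conjI ballI)
    fix q assume q: "q \<in> T - I"
    show "\<exists>t\<in>T - (T - I). E q t"
    proof (rule ccontr)
      assume "\<not> ?thesis"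
      then have no: "\<not> E q t \<and> \<not> E t q" if "t \<in> I" for t
        using that I E_sym[of t q] by blast
      have "\<not> E t t'" if "t \<in> insert q I" "t' \<in> insert q I" for t t'
        using that no[of t] no[of t'] I E_irrefl[of q] by (cases "t = q"; cases "t' = q") blast+
      then have "insert q I \<in> ?\<I>" using I q by blast
      then have "I = insert q I" using bspec[OF max, of "insert q I"] by blast
      then show False using q by blast
    qed
  qed (use I in blast)+
  moreover have "eqv c d" using e1 e2 d(2) eqv_trans by blast
  ultimately show ?thesis using that by blast
qed

lemma three_coloring_clean:
  assumes \<psi>: "proper G 4 \<psi>" "\<And>v. v \<in> S \<union> T \<Longrightarrow> \<psi> v \<in> {1, 2, 3}" and Q: "admissible Q"
  defines "d \<equiv> \<lambda>v. if v \<in> T - Q then 4 else \<psi> v"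
  shows "clean Q d" "eqv \<psi> d"
proof -
  have ne: "\<psi> v \<noteq> 4" if "v \<in> S \<union> T" for v using \<psi>(2)[OF that] by auto
  have "proper G 4 d" "eqv \<psi> d"
    unfolding d_def by (rule recolor_independent[OF \<psi>(1)]; use Q ne in \<open>auto simp: admissible_def\<close>)+
  then show "clean Q d" "eqv \<psi> d"
    using \<psi>(2) Q disj by (auto simp: clean_def d_def admissible_def)
qed

text \<open>Each \<open>q\<close> in \<open>Q\<close> picks an edge to a vertex outside
  \<open>Q\<close>. Such an edge has only one end in \<open>Q\<close>, so different vertices pick
  different edges.\<close>

lemma card_admissible:
  assumes "admissible Q"
  shows "card Q \<le> card (F T)"
proof -
  obtain f where f: "\<And>q. q \<in> Q \<Longrightarrow> f q \<in> T - Q \<and> E q (f q)"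
    using assms unfolding admissible_def by metis
  have "inj_on (\<lambda>q. {q, f q}) Q"
    using f by (auto simp: inj_on_def doubleton_eq_iff)
  moreover have "(\<lambda>q. {q, f q}) ` Q \<subseteq> F T"
    using f assms by (auto simp: F_iff admissible_def)
  ultimately show ?thesis using finite_F by (intro card_inj_on_le)
qed

text \<open>The map \<open>\<pi>\<close> contracts vertices that have the same color in all colorings considered.\<close>

lemma eqv_linked:
  assumes Q: "admissible Q" and \<pi>: "\<And>v. v \<in> S \<union> Q \<Longrightarrow> \<pi> v \<in> W" and W: "W \<subseteq> \<pi> ` (S \<union> Q)"
    and link: "linked {1, 2, 3 :: nat} (\<lambda>a b. \<exists>v\<in>S \<union> Q. \<exists>w\<in>S \<union> Q. E v w \<and> \<pi> v = a \<and> \<pi> w = b) W"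
    and c: "clean Q c" "\<And>v. v \<in> S \<union> Q \<Longrightarrow> c (\<pi> v) = c v"
    and d: "clean Q d" "\<And>v. v \<in> S \<union> Q \<Longrightarrow> d (\<pi> v) = d v"
  shows "eqv c d"
proof -
  let ?R = "\<lambda>a b. \<exists>v\<in>S \<union> Q. \<exists>w\<in>S \<union> Q. E v w \<and> \<pi> v = a \<and> \<pi> w = b"
  \<comment> \<open>Colorings of the contracted graph are pulled back along \<open>\<pi>\<close> and
    completed by color 4; the image of a two-color step is again a change in two colors.\<close>
  define ext where "ext = (\<lambda>f v. if v \<in> T - Q then 4 else f (\<pi> v) :: nat)"
  have on: "coloring_on {1, 2, 3} ?R W e" if e: "clean Q e" "\<And>v. v \<in> S \<union> Q \<Longrightarrow> e (\<pi> v) = e v" for e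
    unfolding coloring_on_def
  proof (intro conjI ballI impI subsetI)
    fix x assume "x \<in> e ` W"
    then obtain v where "v \<in> S \<union> Q" "x = e (\<pi> v)" using W by blast
    then show "x \<in> {1, 2, 3}" using clean_range[OF e(1)] e(2) by metis
  next
    fix a b assume "?R a b"
    then obtain v w where "v \<in> S \<union> Q" "w \<in> S \<union> Q" "E v w" "\<pi> v = a" "\<pi> w = b" by blast
    then show "e a \<noteq> e b" using proper_neq[OF clean_proper[OF e(1)], of v w] e(2) by metis
  qed
  have ext: "proper G 4 (ext f)" if f: "coloring_on {1, 2, 3} ?R W f" for f
  proof -
    have f3: "f (\<pi> v) \<in> {1, 2, 3}" if "v \<in> S \<union> Q" for v
      using f \<pi>[OF that] unfolding coloring_on_def by blast
    have f4: "f (\<pi> v) \<noteq> 4" if "v \<in> S \<union> Q" for v using f3[OF that] by auto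
    show ?thesis
      unfolding proper_def
    proof (intro conjI ballI allI impI)
      fix v assume "v \<in> verts G"
      then have "v \<in> T - Q \<or> v \<in> S \<union> Q" using verts_eq by blast
      then show "ext f v \<in> {1..4}" using f3[of v] by (auto simp: ext_def)
    next
      fix u v assume uv: "E u v"
      then have uQ: "u \<in> T - Q \<or> u \<in> S \<union> Q" "v \<in> T - Q \<or> v \<in> S \<union> Q" using E_verts by blast+
      show "ext f u \<noteq> ext f v"
      proof (cases "u \<in> T - Q"; cases "v \<in> T - Q")
        assume "u \<in> T - Q" "v \<in> T - Q"
        then show ?thesis using Q uv by (auto simp: admissible_def)
      next
        assume "u \<in> T - Q" "v \<notin> T - Q"
        then show ?thesis using f4 uQ by (metis ext_def)
      next
        assume "u \<notin> T - Q" "v \<in> T - Q"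
        then show ?thesis using f4 uQ by (metis ext_def)
      next
        assume uv': "u \<notin> T - Q" "v \<notin> T - Q"
        then have "u \<in> S \<union> Q" "v \<in> S \<union> Q" using uQ by blast+
        then have "f (\<pi> u) \<noteq> f (\<pi> v)"
          using f \<pi> uv unfolding coloring_on_def by blast
        then show ?thesis using uv' unfolding ext_def by metis
      qed
    qed
  qed
  have onc: "coloring_on {1, 2, 3} ?R W c" by (rule on[OF c(1)]) (rule c(2))
  have ond: "coloring_on {1, 2, 3} ?R W d" by (rule on[OF d(1)]) (rule d(2))
  have "(two_color_step {1, 2, 3} ?R W)\<^sup>*\<^sup>* c d"
    using link[unfolded linked_def] onc ond by (elim allE impE)
  then have "eqv (ext c) (ext d)"
  proof (induction rule: rtranclp_induct)
    case base show ?case using ext[OF onc] by (rule eqv_refl)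
  next
    case (step f g)
    then obtain i j where ij: "\<forall>w\<in>W. f w = g w \<or> f w \<in> {i, j} \<and> g w \<in> {i, j}"
      and fg: "coloring_on {1, 2, 3} ?R W f" "coloring_on {1, 2, 3} ?R W g"
      unfolding two_color_step_def by (elim conjE exE)
    have "eqv (ext f) (ext g)"
    proof (rule eqv_two_colors[OF ext[OF fg(1)] ext[OF fg(2)], of i j])
      fix v assume "v \<in> S \<union> T"
      then show "ext f v = ext g v \<or> ext f v \<in> {i, j} \<and> ext g v \<in> {i, j}"
        using bspec[OF ij \<pi>[of v]] by (auto simp: ext_def)
    qed
    with step.IH show ?case by (rule eqv_trans)
  qed
  moreover have same: "eqv e (ext e)"
    if e: "clean Q e" "\<And>v. v \<in> S \<union> Q \<Longrightarrow> e (\<pi> v) = e v" "coloring_on {1, 2, 3} ?R W e" for e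
  proof (rule eqv_two_colors[OF clean_proper[OF e(1)] ext[OF e(3)]])
    fix v assume "v \<in> S \<union> T"
    then have "e v = ext e v" using e(2)[of v] clean_four[OF e(1), of v] by (auto simp: ext_def)
    \<comment> \<open>The two colorings agree on all vertices, so the pair of colors is a
      dummy.\<close>
    then show "e v = ext e v \<or> e v \<in> {0, 0} \<and> ext e v \<in> {0, 0}" by blast
  qed
  have "eqv c (ext c)" by (rule same[OF c(1) _ onc]) (rule c(2))
  moreover have "eqv d (ext d)" by (rule same[OF d(1) _ ond]) (rule d(2))
  ultimately show ?thesis using eqv_trans eqv_sym by meson
qed

text \<open>Every vertex of \<open>Q\<close> is paid for by an edge inside \<open>T\<close>, so
  \<open>card (F S) + card Q\<close> stays within five and the edge count for one additional vertex
  applies without contraction.\<close>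

lemma eqv_clean_single:
  assumes Q: "admissible Q" "Q \<subseteq> {q}" and c: "clean Q c" and d: "clean Q d"
  shows "eqv c d"
proof (rule eqv_linked[OF Q(1), of id "S \<union> Q", OF _ _ _ c _ d])
  let ?R = "\<lambda>a b. \<exists>v\<in>S \<union> Q. \<exists>w\<in>S \<union> Q. E v w \<and> id v = a \<and> id w = b"
  show "linked {1, 2, 3 :: nat} ?R (S \<union> Q)"
  proof (rule linked_few_edges[where F = "F S" and q = q])
    show "symp ?R" by (auto simp: symp_def insert_commute)
    show "{a, b} \<in> F S" if "a \<in> S" "b \<in> S" "?R a b" for a b using that by (simp add: F_iff)
    show "S \<inter> Q = {}" using Q disj by (auto simp: admissible_def)
    show "card (F S) + card Q \<le> 5" using card_admissible[OF Q(1)] F_few(1) by linarith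
    show "coloring_on {1, 2, 3} ?R (S \<union> Q) c"
      using clean_range[OF c] proper_neq[OF clean_proper[OF c]] by (auto simp: coloring_on_def)
  qed (use finite_sides finite_F card_edge Q in auto)
qed auto

end

section \<open>Two exceptional vertices\<close>

context near_bipartite
begin

text \<open>The edges inside \<open>T\<close> are exactly \<open>p q\<close> and \<open>r s\<close>,
  with \<open>p\<close> and \<open>r\<close> the exceptional ends. The case \<open>q = s\<close> is
  included; the two edges then form a path with middle vertex \<open>q\<close>.\<close>

definition pair :: "'a \<Rightarrow> 'a \<Rightarrow> 'a \<Rightarrow> 'a \<Rightarrow> bool" where
  "pair p r q s \<longleftrightarrow> {p, r, q, s} \<subseteq> T \<and> p \<noteq> r \<and> q \<notin> {p, r} \<and> s \<notin> {p, r} \<and>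
     F T = {{p, q}, {r, s}} \<and> card (F S) \<le> 3"

lemma pair_T:
  assumes "pair p r q s"
  shows "p \<in> T" "r \<in> T" "q \<in> T" "s \<in> T" "p \<notin> S" "r \<notin> S" "q \<notin> S" "s \<notin> S"
    "p \<noteq> r" "q \<noteq> p" "q \<noteq> r" "s \<noteq> p" "s \<noteq> r"
  using assms disj by (auto simp: pair_def)

lemma pair_E:
  assumes "pair p r q s" "t \<in> T" "t' \<in> T" "E t t'"
  shows "t = p \<and> t' = q \<or> t = q \<and> t' = p \<or> t = r \<and> t' = s \<or> t = s \<and> t' = r"
proof -
  have "{t, t'} \<in> {{p, q}, {r, s}}" using assms by (metis F_iff pair_def)
  then show ?thesis unfolding insert_iff doubleton_eq_iff by blast
qed

lemma pair_E_pq: "pair p r q s \<Longrightarrow> E p q \<and> E r s"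
  by (metis F_iff insertCI pair_def)

lemma pair_not_E: "pair p r q s \<Longrightarrow> \<not> E p r"
  using pair_E[of p r q s p r] pair_T[of p r q s] by metis

lemma pair_admissible:
  assumes "pair p r q s"
  shows "admissible {p, r}"
  unfolding admissible_def
proof (intro conjI ballI)
  fix t t' assume "t \<in> T - {p, r}" "t' \<in> T - {p, r}"
  then show "\<not> E t t'" using pair_E[OF assms, of t t'] by blast
next
  fix t assume "t \<in> {p, r}"
  then show "\<exists>t'\<in>T - {p, r}. E t t'" using pair_E_pq[OF assms] pair_T[OF assms] by blast
qed (use pair_T[OF assms] in blast)

lemma pair_obtain:
  assumes Q: "admissible {p, r}" and "p \<noteq> r"
  obtains q s where "pair p r q s"
proof -
  have nb: "\<exists>t\<in>T - {p, r}. E x t" if "x \<in> {p, r}" for x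
    using Q that unfolding admissible_def by (elim conjE) (rule bspec)
  obtain q s where qs: "q \<in> T - {p, r}" "E p q" "s \<in> T - {p, r}" "E r s"
    using nb[of p] nb[of r] by blast
  have "p \<in> T" "r \<in> T" using Q by (auto simp: admissible_def)
  then have sub: "{{p, q}, {r, s}} \<subseteq> F T" using qs by (simp add: F_iff)
  have "{p, q} \<noteq> {r, s}" using qs(1,3) assms(2) unfolding doubleton_eq_iff by blast
  then have c2: "card {{p, q}, {r, s}} = 2" by simp
  have "F T = {{p, q}, {r, s}}"
    using card_seteq[OF finite_F sub] c2 F_few(2) by simp
  moreover from this have "card (F S) \<le> 3" using F_few(1) c2 by simp
  ultimately have "pair p r q s"
    unfolding pair_def using qs(1,3) \<open>p \<in> T\<close> \<open>r \<in> T\<close> assms(2) by simp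
  then show ?thesis by (rule that)
qed

text \<open>Edges inside \<open>T\<close> need no hypothesis: each has one end in
  \<open>{p, r}\<close>, colored from 1, 2, 3, and one end colored 4.\<close>

lemma clean_pairI:
  assumes pair: "pair p r q s" and range: "\<And>v. v \<in> S \<union> {p, r} \<Longrightarrow> c v \<in> {1, 2, 3}"
    and four: "\<And>t. t \<in> T - {p, r} \<Longrightarrow> c t = 4"
    and SS: "\<And>u v. u \<in> S \<Longrightarrow> v \<in> S \<Longrightarrow> E u v \<Longrightarrow> c u \<noteq> c v"
    and Sp: "\<And>u. u \<in> S \<Longrightarrow> E u p \<Longrightarrow> c u \<noteq> c p" and Sr: "\<And>u. u \<in> S \<Longrightarrow> E u r \<Longrightarrow> c u \<noteq> c r"
  shows "clean {p, r} c"
proof -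
  have ne: "c v \<noteq> 4" if "v \<in> S \<union> {p, r}" for v using range[OF that] by auto
  have "proper G 4 c"
  proof (rule properI[OF _ SS])
    fix v assume "v \<in> S \<union> T"
    then have "v \<in> S \<union> {p, r} \<or> v \<in> T - {p, r}" by blast
    then show "c v \<in> {1..4}" using range[of v] four[of v] by auto
  next
    fix t t' assume t: "t \<in> T" "t' \<in> T" "E t t'"
    have "c p \<noteq> 4" "c r \<noteq> 4" "c q = 4" "c s = 4" using ne four pair_T[OF pair] by blast+
    then show "c t \<noteq> c t'" using pair_E[OF pair t] by metis
  next
    fix u t assume "u \<in> S" "t \<in> T" "E u t"
    then show "c u \<noteq> c t" using Sp Sr ne[of u] four[of t] by (cases "t \<in> {p, r}") auto
  qed
  then show ?thesis using range four by (auto simp: clean_def)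
qed

section \<open>Giving the two exceptional vertices the same color\<close>

lemma clean_neq: "clean Q c \<Longrightarrow> E u v \<Longrightarrow> c u \<noteq> c v"
  using clean_proper proper_neq by blast

text \<open>Once \<open>p\<close> and \<open>r\<close> have equal colors they can be identified,
  which reduces two additional vertices to one.\<close>

definition equalizable :: "'a \<Rightarrow> 'a \<Rightarrow> ('a \<Rightarrow> nat) \<Rightarrow> bool" where
  "equalizable p r c \<longleftrightarrow> (\<exists>d. clean {p, r} d \<and> d p = d r \<and> eqv c d)"

lemma equalizable_sym: "equalizable p r c \<Longrightarrow> equalizable r p c"
  unfolding equalizable_def by (metis insert_commute)

lemma equalizable_eqv: "eqv c d \<Longrightarrow> equalizable p r d \<Longrightarrow> equalizable p r c"
  unfolding equalizable_def using eqv_trans by blast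

lemma pair_sym: "pair p r q s \<Longrightarrow> pair r p s q"
  unfolding pair_def by (auto simp: insert_commute)

text \<open>After \<open>r\<close> is identified with \<open>p\<close>, the graph consists of
  \<open>S\<close> with at most three edges and a single further vertex, well within the bound for
  few edges.\<close>

lemma eqv_clean_equal:
  assumes pair: "pair p r q s" and c: "clean {p, r} c" "c p = c r" and d: "clean {p, r} d" "d p = d r"
  shows "eqv c d"
proof (rule eqv_linked[OF pair_admissible[OF pair], of "\<lambda>v. if v = r then p else v" "S \<union> {p}", OF _ _ _ c(1) _ d(1)])
  let ?\<pi> = "\<lambda>v. if v = r then p else v"
  let ?R = "\<lambda>a b. \<exists>v\<in>S \<union> {p, r}. \<exists>w\<in>S \<union> {p, r}. E v w \<and> ?\<pi> v = a \<and> ?\<pi> w = b"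
  note pT = pair_T[OF pair]
  show "S \<union> {p} \<subseteq> ?\<pi> ` (S \<union> {p, r})"
  proof
    fix v assume "v \<in> S \<union> {p}"
    then have "v = ?\<pi> v" "v \<in> S \<union> {p, r}" using pT by auto
    then show "v \<in> ?\<pi> ` (S \<union> {p, r})" by (rule image_eqI)
  qed
  show "linked {1, 2, 3 :: nat} ?R (S \<union> {p})"
  proof (rule linked_few_edges[where F = "F S" and q = p])
    show "symp ?R" unfolding symp_def using E_sym by blast
    show "{a, b} \<in> F S" if "a \<in> S" "b \<in> S" "?R a b" for a b
      using that pT(5,6) unfolding F_iff by (metis UnE empty_iff insert_iff)
    show "S \<inter> {p} = {}" using pT by blast
    show "card (F S) + card {p} \<le> 5" using pair by (simp add: pair_def)
    show "coloring_on {1, 2, 3} ?R (S \<union> {p}) c"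
      unfolding coloring_on_def
    proof (intro conjI ballI impI)
      show "c ` (S \<union> {p}) \<subseteq> {1, 2, 3}" using clean_range[OF c(1)] by blast
      fix a b assume "?R a b"
      then obtain v w where vw: "E v w" "?\<pi> v = a" "?\<pi> w = b" by blast
      then have "c v = c a" "c w = c b" using c(2) by metis+
      then show "c a \<noteq> c b" using clean_neq[OF c(1) vw(1)] by simp
    qed
  qed (use finite_sides finite_F card_edge in auto)
qed (use c(2) d(2) in auto)

text \<open>The Kempe chain of \<open>r\<close> in the colors of \<open>r\<close> and
  \<open>p\<close> stops after one step: by \<open>free\<close> it reaches only neighbors of
  \<open>r\<close> in \<open>S\<close> colored like \<open>p\<close>. These are not adjacent to
  \<open>p\<close>, so swapping the chain gives \<open>r\<close> the color of
  \<open>p\<close>.\<close>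

lemma equalizable_swap:
  assumes pair: "pair p r q s" and c: "clean {p, r} c"
    and free: "\<And>u v. u \<in> S \<Longrightarrow> v \<in> S \<Longrightarrow> E u v \<Longrightarrow> c u = c r \<Longrightarrow> c v = c p \<Longrightarrow> \<not> E v r"
  shows "equalizable p r c"
proof -
  note pT = pair_T[OF pair]
  define d where "d = (\<lambda>v. if v = r then c p else if v \<in> S \<and> c v = c p \<and> E v r then c r else c v)"
  have d: "clean {p, r} d"
  proof (rule clean_pairI[OF pair])
    show "d v \<in> {1, 2, 3}" if "v \<in> S \<union> {p, r}" for v
      using clean_range[OF c, of v] clean_range[OF c, of p] clean_range[OF c, of r] that
      by (simp add: d_def)
    show "d t = 4" if "t \<in> T - {p, r}" for t
      using clean_four[OF c that] that disj by (auto simp: d_def)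
    show "d u \<noteq> d p" if "u \<in> S" "E u p" for u
    proof -
      have "c u \<noteq> c p" by (rule clean_neq[OF c that(2)])
      then show ?thesis using that pT by (auto simp: d_def)
    qed
    show "d u \<noteq> d r" if "u \<in> S" "E u r" for u
    proof -
      have "c u \<noteq> c r" by (rule clean_neq[OF c that(2)])
      then show ?thesis using that pT by (auto simp: d_def)
    qed
    show "d u \<noteq> d v" if uv: "u \<in> S" "v \<in> S" "E u v" for u v
    proof -
      have "c u \<noteq> c v" by (rule clean_neq[OF c uv(3)])
      moreover have "u \<noteq> r" "v \<noteq> r" using uv pT by blast+
      ultimately show ?thesis
        using free[OF uv] free[OF uv(2,1) E_sym[OF uv(3)]] uv unfolding d_def by metis
    qed
  qed
  moreover have "d p = d r" using pT by (simp add: d_def)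
  moreover have "eqv c d"
    by (rule eqv_two_colors[OF clean_proper[OF c] clean_proper[OF d], of "c p" "c r"])
      (auto simp: d_def)
  ultimately show ?thesis unfolding equalizable_def by blast
qed

section \<open>The path obstruction inside S\<close>

lemma recolor_S:
  assumes pair: "pair p r q s" and c: "clean {p, r} c" and w: "w \<in> S" and k: "k \<in> {1, 2, 3}"
    and free: "\<And>z. E w z \<Longrightarrow> z \<in> S \<union> {p, r} \<Longrightarrow> c z \<noteq> k"
  shows "clean {p, r} (c(w := k)) \<and> eqv c (c(w := k))"
proof -
  note pT = pair_T[OF pair]
  have d: "clean {p, r} (c(w := k))"
  proof (rule clean_pairI[OF pair])
    show "(c(w := k)) v \<in> {1, 2, 3}" if "v \<in> S \<union> {p, r}" for v
      using clean_range[OF c that] k by simp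
    show "(c(w := k)) t = 4" if "t \<in> T - {p, r}" for t
      using clean_four[OF c that] that w disj by auto
    show "(c(w := k)) u \<noteq> (c(w := k)) p" if "u \<in> S" "E u p" for u
      using clean_neq[OF c that(2)] free[of p] that w pT by auto
    show "(c(w := k)) u \<noteq> (c(w := k)) r" if "u \<in> S" "E u r" for u
      using clean_neq[OF c that(2)] free[of r] that w pT by auto
    show "(c(w := k)) u \<noteq> (c(w := k)) v" if "u \<in> S" "v \<in> S" "E u v" for u v
      using clean_neq[OF c that(3)] free[of u] free[of v] that E_sym[OF that(3)] E_irrefl
      by (metis UnI1 fun_upd_apply)
  qed
  have "eqv c (c(w := k))"
    by (rule eqv_independent[OF clean_proper[OF c] clean_proper[OF d]]) (use E_irrefl in auto)
  with d show ?thesis ..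
qed

text \<open>The vertices \<open>x\<close>, \<open>u\<close>, \<open>v\<close>, \<open>y\<close> are
  consecutive along a walk in \<open>S\<close>. The middle edge carries the colors of
  \<open>r\<close> and \<open>p\<close>, and both ends carry the third color, which prevents
  \<open>u\<close> and \<open>v\<close> from taking it. Here \<open>x = y\<close> is allowed and
  means a triangle.\<close>

definition stuck :: "'a \<Rightarrow> 'a \<Rightarrow> 'a \<Rightarrow> 'a \<Rightarrow> 'a \<Rightarrow> 'a \<Rightarrow> ('a \<Rightarrow> nat) \<Rightarrow> bool" where
  "stuck p r u v x y c \<longleftrightarrow> clean {p, r} c \<and> {u, v, x, y} \<subseteq> S \<and> E u v \<and> E u x \<and> E v y \<and>
     c u = c r \<and> c v = c p \<and> c y = c x \<and> c r \<noteq> c p \<and> c x \<noteq> c p \<and> c x \<noteq> c r"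

lemma stuck_sym: "stuck p r u v x y c \<Longrightarrow> stuck r p v u y x c"
  unfolding stuck_def by (auto simp: insert_commute)

text \<open>Three distinct edges exhaust \<open>F S\<close>. Nothing separates \<open>x\<close> from
  \<open>y\<close>, so the statement serves for a triangle as well as for a path.\<close>

lemma path_edges:
  assumes "card (F S) \<le> 3" "{u, v, x, y} \<subseteq> S" "E u v" "E u x" "E v y"
    and "u \<noteq> v" "x \<noteq> v" "y \<noteq> u"
  shows "F S = {{u, v}, {u, x}, {v, y}}"
proof -
  have "{{u, v}, {u, x}, {v, y}} \<subseteq> F S" using assms(2-5) by (simp add: F_iff)
  moreover have "{u, v} \<noteq> {u, x}" "{u, v} \<noteq> {v, y}" "{u, x} \<noteq> {v, y}"
    using assms(6-8) by (auto simp: doubleton_eq_iff)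
  then have "card {{u, v}, {u, x}, {v, y}} = 3" by simp
  ultimately show ?thesis using card_seteq[OF finite_F, of "{{u, v}, {u, x}, {v, y}}" S] assms(1) by simp
qed

lemma stuck_E:
  assumes "pair p r q s" "stuck p r u v x y c" "a \<in> S" "b \<in> S" "E a b"
  shows "a = u \<and> b = v \<or> a = v \<and> b = u \<or> a = u \<and> b = x \<or> a = x \<and> b = u \<or> a = v \<and> b = y \<or> a = y \<and> b = v"
proof -
  have "F S = {{u, v}, {u, x}, {v, y}}"
    using assms(1,2) by (intro path_edges) (auto simp: pair_def stuck_def)
  then have "{a, b} \<in> {{u, v}, {u, x}, {v, y}}" using assms(3-5) by (metis F_iff)
  then show ?thesis unfolding insert_iff doubleton_eq_iff by blast
qed

text \<open>An edge of \<open>S\<close> in the colors of \<open>r\<close> and \<open>p\<close>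
  disappears if one of its ends can take the third color \<open>k\<close>. This creates no new such
  edge and leaves \<open>p\<close> and \<open>r\<close> unchanged, so the number of these edges
  decreases until none is left or one has a neighbor colored \<open>k\<close> at each end.\<close>

lemma equalizable_or_stuck:
  assumes pair: "pair p r q s" and c: "clean {p, r} c" "c p \<noteq> c r"
  shows "equalizable p r c \<or> (\<exists>u v x y d. stuck p r u v x y d \<and> eqv c d)"
  using c
proof (induction "card {(u, v). u \<in> S \<and> v \<in> S \<and> E u v \<and> c u = c r \<and> c v = c p}" arbitrary: c
    rule: less_induct)
  case less
  note pT = pair_T[OF pair]
  let ?M = "\<lambda>c. {(u, v). u \<in> S \<and> v \<in> S \<and> E u v \<and> c u = c r \<and> c v = c p}"
  have finM: "finite (?M c)" for c :: "'a \<Rightarrow> nat"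
    by (rule finite_subset[of _ "S \<times> S"]) (use finite_sides in auto)
  show ?case
  proof (cases "?M c = {}")
    case True
    then show ?thesis using equalizable_swap[OF pair less.prems(1)] by blast
  next
    case False
    then obtain u v where uv: "u \<in> S" "v \<in> S" "E u v" "c u = c r" "c v = c p" by blast
    have "\<exists>k\<in>{1, 2, 3}. k \<noteq> c p \<and> k \<noteq> c r"
      by (cases "1 \<in> {c p, c r}"; cases "2 \<in> {c p, c r}") auto
    then obtain k where k: "k \<in> {1, 2, 3}" "k \<noteq> c p" "k \<noteq> c r" by blast
    show ?thesis
    proof (cases "\<exists>w\<in>{u, v}. \<forall>z\<in>S. E w z \<longrightarrow> c z \<noteq> k")
      case True
      then obtain w where w: "w \<in> {u, v}" "\<And>z. z \<in> S \<Longrightarrow> E w z \<Longrightarrow> c z \<noteq> k" by blast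
      then have wS: "w \<in> S" using uv by blast
      let ?d = "c(w := k)"
      have d: "clean {p, r} ?d" "eqv c ?d"
        using recolor_S[OF pair less.prems(1) wS k(1)] w(2) k(2,3) by blast+
      have dp: "?d p = c p" "?d r = c r" using wS pT by auto
      have "?M ?d \<subseteq> ?M c" unfolding dp using k(2,3) by (auto split: if_splits)
      moreover have "(u, v) \<in> ?M c - ?M ?d" unfolding dp using uv w(1) k(2,3) by auto
      ultimately have "?M ?d \<subset> ?M c" by blast
      then have "card (?M ?d) < card (?M c)" by (rule psubset_card_mono[OF finM])
      from less.hyps[OF this d(1)] show ?thesis
        using less.prems(2) dp equalizable_eqv[OF d(2)] eqv_trans[OF d(2)] by metis
    next
      case False
      then obtain x y where "x \<in> S" "E u x" "c x = k" "y \<in> S" "E v y" "c y = k" by blast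
      then have "stuck p r u v x y c"
        using uv k less.prems unfolding stuck_def by auto
      then show ?thesis using eqv_refl[OF clean_proper[OF less.prems(1)]] by blast
    qed
  qed
qed

text \<open>If \<open>x\<close> can take the color of \<open>p\<close>, the third color becomes free
  for \<open>u\<close>. After both moves no path vertex has the color of \<open>r\<close>, so the
  chain from \<open>r\<close> is short.\<close>

lemma stuck_not_E_x_p:
  assumes pair: "pair p r q s" and st: "stuck p r u v x y c" and xy: "x \<noteq> y" and no: "\<not> E x p"
  shows "equalizable p r c"
proof -
  note pT = pair_T[OF pair]
  have c: "clean {p, r} c" and S: "u \<in> S" "v \<in> S" "x \<in> S" "y \<in> S"
    and cs: "c u = c r" "c v = c p" "c y = c x" "c r \<noteq> c p" "c x \<noteq> c p" "c x \<noteq> c r"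
    using st by (auto simp: stuck_def)
  have ne: "u \<noteq> v" "x \<noteq> u" "x \<noteq> v" "y \<noteq> u" "y \<noteq> v" using cs by metis+
  note SE = stuck_E[OF pair st]
  let ?c1 = "c(x := c p)" let ?c2 = "?c1(u := c x)"
  have c1: "clean {p, r} ?c1 \<and> eqv c ?c1"
  proof (rule recolor_S[OF pair c S(3) clean_range[OF c]])
    show "c z \<noteq> c p" if "E x z" "z \<in> S \<union> {p, r}" for z
      using SE[of x z] that S(3) ne xy cs no by (cases "z \<in> S") auto
  qed auto
  have c2: "clean {p, r} ?c2 \<and> eqv ?c1 ?c2"
  proof (rule recolor_S[OF pair conjunct1[OF c1] S(1) clean_range[OF c]])
    show "?c1 z \<noteq> c x" if "E u z" "z \<in> S \<union> {p, r}" for z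
      using SE[of u z] that S ne xy cs by (cases "z \<in> S") auto
  qed (use S in auto)
  have "equalizable p r ?c2"
  proof (rule equalizable_swap[OF pair conjunct1[OF c2]])
    fix a b assume ab: "a \<in> S" "b \<in> S" "E a b" "?c2 a = ?c2 r" "?c2 b = ?c2 p"
    have "?c2 r = c r" "?c2 p = c p" using S pT by auto
    then show "\<not> E b r" using SE[OF ab(1-3)] ab(4,5) ne cs xy by auto
  qed
  then show ?thesis using equalizable_eqv c1 c2 by blast
qed

text \<open>Exchanging the colors of \<open>u\<close> and \<open>x\<close> is possible when
  \<open>x\<close> does not see \<open>r\<close>; afterwards no edge inside \<open>S\<close> carries
  the colors of \<open>r\<close> and \<open>p\<close>.\<close>

lemma stuck_not_E_x_r:
  assumes pair: "pair p r q s" and st: "stuck p r u v x y c" and xy: "x \<noteq> y" and no: "\<not> E x r"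
  shows "equalizable p r c"
proof -
  note pT = pair_T[OF pair]
  have c: "clean {p, r} c" and S: "u \<in> S" "v \<in> S" "x \<in> S" "y \<in> S"
    and cs: "c u = c r" "c v = c p" "c y = c x" "c r \<noteq> c p" "c x \<noteq> c p" "c x \<noteq> c r"
    using st by (auto simp: stuck_def)
  have ne: "u \<noteq> v" "x \<noteq> u" "x \<noteq> v" "y \<noteq> u" "y \<noteq> v" using cs by metis+
  note SE = stuck_E[OF pair st]
  define d where "d = c(u := c x, x := c r)"
  have dT: "d t = c t" if "t \<in> T" for t using that S disj by (auto simp: d_def)
  have d: "clean {p, r} d"
  proof (rule clean_pairI[OF pair])
    show "d v \<in> {1, 2, 3}" if "v \<in> S \<union> {p, r}" for v
      using clean_range[OF c, of v] clean_range[OF c, of x] clean_range[OF c, of r] S that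
      by (simp add: d_def)
    show "d t = 4" if "t \<in> T - {p, r}" for t using clean_four[OF c that] dT that by simp
    show "d a \<noteq> d p" if "a \<in> S" "E a p" for a
      using clean_neq[OF c that(2)] dT[OF pT(1)] cs by (auto simp: d_def)
    show "d a \<noteq> d r" if "a \<in> S" "E a r" for a
      using clean_neq[OF c that(2)] dT[OF pT(2)] cs no that(2) by (auto simp: d_def)
    show "d a \<noteq> d b" if "a \<in> S" "b \<in> S" "E a b" for a b
      using SE[OF that] cs ne xy by (auto simp: d_def)
  qed
  have "eqv c d"
    by (rule eqv_two_colors[OF clean_proper[OF c] clean_proper[OF d], of "c r" "c x"])
      (use cs in \<open>auto simp: d_def\<close>)
  moreover have "equalizable p r d"
  proof (rule equalizable_swap[OF pair d])
    fix a b assume ab: "a \<in> S" "b \<in> S" "E a b" "d a = d r" "d b = d p"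
    then show "\<not> E b r" using SE[OF ab(1-3)] ne cs xy dT[OF pT(1)] dT[OF pT(2)] by (auto simp: d_def)
  qed
  ultimately show ?thesis by (rule equalizable_eqv)
qed

text \<open>The edge \<open>u v\<close> is the only one inside \<open>S\<close> in the colors of
  \<open>r\<close> and \<open>p\<close>, so it blocks the swap at \<open>r\<close> only through
  \<open>v\<close>.\<close>

lemma stuck_not_E_v_r:
  assumes pair: "pair p r q s" and st: "stuck p r u v x y c" and no: "\<not> E v r"
  shows "equalizable p r c"
proof (rule equalizable_swap[OF pair])
  show "clean {p, r} c" using st by (simp add: stuck_def)
  fix a b assume ab: "a \<in> S" "b \<in> S" "E a b" "c a = c r" "c b = c p"
  then show "\<not> E b r" using stuck_E[OF pair st ab(1-3)] no st unfolding stuck_def by metis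
qed

text \<open>Reversing the path and exchanging \<open>p\<close> with \<open>r\<close> turns three
  forced edges into six. With the path they form the triangular prism: triangles \<open>p\<close>,
  \<open>u\<close>, \<open>x\<close> and \<open>r\<close>, \<open>v\<close>, \<open>y\<close>,
  matched by \<open>u v\<close>, \<open>p y\<close> and \<open>x r\<close>.\<close>

lemma stuck_adjacent:
  assumes "pair p r q s" "stuck p r u v x y c" "x \<noteq> y" "\<not> equalizable p r c"
  shows "E u p" "E x p" "E y p" "E v r" "E x r" "E y r"
  using assms stuck_not_E_x_p stuck_not_E_x_r stuck_not_E_v_r equalizable_sym pair_sym stuck_sym by metis+

text \<open>A triangle uses up all edges inside \<open>S\<close>. A core containing \<open>p\<close>
  or \<open>r\<close> would make that vertex adjacent to the whole triangle, giving a complete graph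
  on four vertices; a core inside \<open>S\<close> has degrees at most two. So every vertex can be
  deleted.\<close>

lemma eqv_clean_triangle:
  assumes pair: "pair p r q s" and S: "{u, v, x} \<subseteq> S" and tri: "E u v" "E u x" "E v x"
    and c: "clean {p, r} c" and d: "clean {p, r} d"
  shows "eqv c d"
proof (rule eqv_linked[OF pair_admissible[OF pair], of id "S \<union> {p, r}", OF _ _ _ c _ d])
  note pT = pair_T[OF pair]
  let ?R = "\<lambda>a b. \<exists>v\<in>S \<union> {p, r}. \<exists>w\<in>S \<union> {p, r}. E v w \<and> id v = a \<and> id w = b"
  have uvx: "u \<noteq> v" "u \<noteq> x" "v \<noteq> x" using tri E_irrefl by metis+
  have "F S = {{u, v}, {u, x}, {v, x}}"
    using pair S tri uvx by (intro path_edges) (auto simp: pair_def)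
  then have SE: "a \<in> {u, v, x} \<and> b \<in> {u, v, x} - {a}" if "a \<in> S" "b \<in> S" "E a b" for a b
    using that F_iff[of a b S] E_irrefl by (auto simp: doubleton_eq_iff)
  show "linked {1, 2, 3 :: nat} ?R (S \<union> {p, r})"
  proof (rule linked_degenerate)
    fix W assume W: "W \<subseteq> S \<union> {p, r}" "W \<noteq> {}" "\<forall>w\<in>W. card {1, 2, 3 :: nat} \<le> card {z \<in> W. ?R w z}"
    have K3: "card {1, 2, 3 :: nat} = 3" by simp
    have deg: "3 \<le> card A" if "w \<in> W" "finite A" "\<And>z. z \<in> W \<Longrightarrow> E w z \<Longrightarrow> z \<in> A" for w A
    proof -
      have "3 \<le> card {z \<in> W. ?R w z}" using bspec[OF W(3) that(1)] unfolding K3 .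
      also have "\<dots> \<le> card A" by (rule card_mono[OF that(2)]) (use that(3) in auto)
      finally show ?thesis .
    qed
    have exc: "w \<notin> W" if w: "w \<in> {p, r}" for w
    proof
      assume wW: "w \<in> W"
      have nT: "z \<in> S" if "z \<in> W" "E w z" for z
        using that W(1) w pair_not_E[OF pair] E_sym E_irrefl by blast
      define A where "A = {z \<in> {u, v, x}. E w z}"
      \<comment> \<open>Vertices of \<open>S\<close> off the triangle see at most \<open>p\<close>
        and \<open>r\<close>, too few for a core.\<close>
      have sub: "z \<in> {u, v, x}" if "z \<in> W" "E w z" for z
      proof (rule ccontr)
        assume z: "z \<notin> {u, v, x}"
        have "3 \<le> card {p, r}"
        proof (rule deg[OF that(1)])
          fix z' assume "z' \<in> W" "E z z'"
          then show "z' \<in> {p, r}" using SE[of z z'] nT[OF that] W(1) z by blast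
        qed simp
        then show False using pT by simp
      qed
      have "3 \<le> card A" by (rule deg[OF wW]) (use sub in \<open>auto simp: A_def\<close>)
      moreover have "A \<subseteq> {u, v, x}" by (auto simp: A_def)
      moreover have "card {u, v, x} = 3" using uvx by simp
      ultimately have "A = {u, v, x}" by (intro card_seteq) auto
      then have "E w u" "E w v" "E w x" by (auto simp: A_def)
      then have "c w \<noteq> c u" "c w \<noteq> c v" "c w \<noteq> c x" "c u \<noteq> c v" "c u \<noteq> c x" "c v \<noteq> c x"
        using clean_neq[OF c] tri by blast+
      moreover have "c w \<in> {1, 2, 3}" "c u \<in> {1, 2, 3}" "c v \<in> {1, 2, 3}" "c x \<in> {1, 2, 3}"
        using clean_range[OF c] w S by blast+
      ultimately show False by auto
    qed
    obtain w where w: "w \<in> W" using W(2) by blast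
    then have "w \<in> S" using W(1) exc by blast
    have "3 \<le> card ({u, v, x} - {w})"
    proof (rule deg[OF w])
      fix z assume "z \<in> W" "E w z"
      then show "z \<in> {u, v, x} - {w}" using SE[of w z] \<open>w \<in> S\<close> W(1) exc by blast
    qed simp
    moreover have mem: "w \<in> {u, v, x}"
    proof (rule ccontr)
      assume "w \<notin> {u, v, x}"
      have "3 \<le> card ({} :: 'a set)"
        by (rule deg[OF w]) (use SE[of w] \<open>w \<in> S\<close> W(1) exc \<open>w \<notin> {u, v, x}\<close> in blast)+
      then show False by simp
    qed
    moreover have "card {u, v, x} = 3" using uvx by simp
    ultimately have False unfolding card_Diff_singleton[OF mem] by linarith
    then show "linked {1, 2, 3 :: nat} ?R W" ..
  next
    show "symp ?R" unfolding symp_def using E_sym by blast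
  qed (use finite_sides in auto)
qed auto

end

section \<open>Colorings with disjoint color sets on the two sides\<close>

context near_bipartite
begin

text \<open>A common target for different exceptional sets: the two sides use disjoint pairs of
  colors and can be recolored independently of each other.\<close>

definition split_coloring :: "('a \<Rightarrow> nat) \<Rightarrow> bool" where
  "split_coloring c \<longleftrightarrow> proper G 4 c \<and> (\<forall>v\<in>S. c v \<in> {1, 2}) \<and> (\<forall>v\<in>T. c v \<in> {3, 4})"

lemma eqv_split_coloring:
  assumes c: "split_coloring c" and d: "split_coloring d"
  shows "eqv c d"
proof -
  have cp: "proper G 4 c" and dp: "proper G 4 d" using c d by (auto simp: split_coloring_def)
  define e where "e = (\<lambda>v. if v \<in> S then d v else c v)"
  have ST: "v \<notin> S" if "v \<in> T" for v using that disj by blast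
  have e: "proper G 4 e"
  proof (rule properI)
    fix v assume v: "v \<in> S \<union> T"
    show "e v \<in> {1..4}" using proper_range[OF cp v] proper_range[OF dp v] by (simp add: e_def)
  next
    fix u v assume uv: "u \<in> S" "v \<in> T" "E u v"
    then have "e u \<in> {1, 2}" "e v \<in> {3, 4}" using c d ST by (auto simp: split_coloring_def e_def)
    then show "e u \<noteq> e v" by auto
  qed (use proper_neq[OF cp] proper_neq[OF dp] ST in \<open>auto simp: e_def\<close>)
  have "eqv c e"
    by (rule eqv_two_colors[OF cp e, of 1 2]) (use c d in \<open>auto simp: split_coloring_def e_def\<close>)
  also have "eqv e d"
    by (rule eqv_two_colors[OF e dp, of 3 4]) (use c d ST in \<open>auto simp: split_coloring_def e_def\<close>)
  finally show ?thesis .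
qed

text \<open>Only \<open>T\<close> is recolored, with 3 on \<open>Q\<close> and 4 elsewhere;
  independence of \<open>Q\<close> keeps this proper.\<close>

lemma split_coloring_clean:
  assumes \<chi>: "split_coloring \<chi>" and Q: "admissible Q"
    and ind: "\<And>t t'. t \<in> Q \<Longrightarrow> t' \<in> Q \<Longrightarrow> \<not> E t t'"
  obtains d where "clean Q d" "\<And>q. q \<in> Q \<Longrightarrow> d q = 3" "eqv d \<chi>"
proof -
  define d where "d = (\<lambda>v. if v \<in> S then \<chi> v else if v \<in> Q then 3 else 4)"
  have ST: "v \<notin> S" if "v \<in> T" for v using that disj by blast
  have QT: "Q \<subseteq> T" using Q by (simp add: admissible_def)
  have dS: "d v \<in> {1, 2}" if "v \<in> S" for v using \<chi> that by (simp add: split_coloring_def d_def)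
  have dT: "d v = (if v \<in> Q then 3 else 4)" if "v \<in> T" for v using ST[OF that] by (simp add: d_def)
  have d: "proper G 4 d"
  proof (rule properI)
    fix v assume "v \<in> S \<union> T" then show "d v \<in> {1..4}" using dS[of v] dT[of v] by auto
  next
    fix u v assume "u \<in> S" "v \<in> S" "E u v" then show "d u \<noteq> d v"
      using \<chi> proper_neq[of \<chi> u v] by (simp add: split_coloring_def d_def)
  next
    fix u v assume "u \<in> T" "v \<in> T" "E u v" then show "d u \<noteq> d v"
      using dT ind Q by (auto simp: admissible_def)
  next
    fix u v assume "u \<in> S" "v \<in> T" "E u v" then show "d u \<noteq> d v" using dS[of u] dT[of v] by auto
  qed
  have "split_coloring d" using d dS dT by (auto simp: split_coloring_def)
  then have "eqv d \<chi>" using \<chi> by (rule eqv_split_coloring)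
  moreover have "clean Q d" unfolding clean_def using d dS dT QT by fastforce
  moreover have "d q = 3" if "q \<in> Q" for q using dT that QT by auto
  ultimately show ?thesis using that by blast
qed

lemma eqv_split_single:
  assumes \<chi>: "split_coloring \<chi>" and Q: "admissible {q}" and c: "clean {q} c"
  shows "eqv c \<chi>"
proof -
  obtain d where "clean {q} d" "eqv d \<chi>"
    using split_coloring_clean[OF \<chi> Q] E_irrefl by blast
  then show ?thesis using eqv_clean_single[OF Q _ c] eqv_trans by blast
qed

lemma eqv_split_equalizable:
  assumes \<chi>: "split_coloring \<chi>" and pair: "pair p r q s" and c: "equalizable p r c"
  shows "eqv c \<chi>"
proof -
  obtain c' where c': "clean {p, r} c'" "c' p = c' r" "eqv c c'"
    using c by (auto simp: equalizable_def)
  have "\<not> E t t'" if "t \<in> {p, r}" "t' \<in> {p, r}" for t t'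
    using that pair_not_E[OF pair] E_sym[of r p] E_irrefl by blast
  then obtain d where d: "clean {p, r} d" "\<And>q. q \<in> {p, r} \<Longrightarrow> d q = 3" "eqv d \<chi>"
    using split_coloring_clean[OF \<chi> pair_admissible[OF pair]] by metis
  have "eqv c' d" by (rule eqv_clean_equal[OF pair c'(1,2) d(1)]) (simp add: d(2))
  then show ?thesis using c'(3) d(3) eqv_trans by blast
qed

text \<open>The exceptional vertex \<open>p\<close> is replaced by its neighbor \<open>q\<close>, which also
  replaces \<open>r\<close> if \<open>q = s\<close>.\<close>

lemma exchange_exceptional:
  assumes pair: "pair p r q s" and c: "clean {p, r} c" and z: "z \<in> {1, 2, 3}"
    and free: "\<forall>w\<in>S. E w q \<longrightarrow> c w \<noteq> z"
  defines "d \<equiv> c(q := z, p := 4, r := if q = s then 4 else c r)"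
  shows "eqv c d" "q = s \<Longrightarrow> clean {q} d \<and> admissible {q}"
    "q \<noteq> s \<Longrightarrow> clean {q, r} d \<and> pair q r p s"
proof -
  note pT = pair_T[OF pair]
  \<comment> \<open>The adjacent vertices \<open>p\<close> and \<open>q\<close> both change, so the
    passage is split. The step to \<open>e\<close> involves only the colors \<open>z\<close> and 4;
    what remains concerns only \<open>p\<close> and \<open>r\<close>, which are not
    adjacent.\<close>
  define e where "e = c(q := z, p := if c p = z then 4 else c p,
    r := if q = s \<and> c r = z then 4 else c r)"
  have cS: "c w \<in> {1, 2, 3}" if "w \<in> S" for w using clean_range[OF c] that by blast
  then have cS4: "c w \<noteq> 4" if "w \<in> S" for w using that by fastforce
  have cpr: "c p \<in> {1, 2, 3}" "c r \<in> {1, 2, 3}" using clean_range[OF c] by blast+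
  then have cpr4: "c p \<noteq> 4" "c r \<noteq> 4" by auto
  have z4: "z \<noteq> 4" using z by auto
  have c4: "c t = 4" if "t \<in> T" "t \<noteq> p" "t \<noteq> r" for t using clean_four[OF c] that by blast
  have neT: "w \<noteq> p" "w \<noteq> q" "w \<noteq> r" if "w \<in> S" for w using that pT by blast+
  have dS: "d w = c w" "e w = c w" if "w \<in> S" for w using neT[OF that] by (simp_all add: d_def e_def)
  have dq: "d q = z" "d p = 4" "e q = z" "e p = (if c p = z then 4 else c p)"
    "d r = (if q = s then 4 else c r)" "e r = (if q = s \<and> c r = z then 4 else c r)"
    using pT by (simp_all add: d_def e_def)
  have dT: "d t = 4" "e t = 4" if "t \<in> T" "t \<noteq> p" "t \<noteq> r" "t \<noteq> q" for t
    using c4 that by (simp_all add: d_def e_def)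
  have ds: "q \<noteq> s \<Longrightarrow> d s = 4 \<and> e s = 4" using dT pT by metis
  have e: "proper G 4 e"
  proof (rule properI)
    fix v assume "v \<in> S \<union> T"
    then show "e v \<in> {1..4}" using proper_range[OF clean_proper[OF c], of v] z by (auto simp: e_def)
  next
    fix u v assume "u \<in> S" "v \<in> S" "E u v"
    then show "e u \<noteq> e v" using clean_neq[OF c] dS by metis
  next
    fix t t' assume "t \<in> T" "t' \<in> T" "E t t'"
    from pair_E[OF pair this] show "e t \<noteq> e t'" using dq ds cpr4 z4 by (metis (full_types))
  next
    fix u t assume ut: "u \<in> S" "t \<in> T" "E u t"
    have "c u \<noteq> c t" by (rule clean_neq[OF c ut(3)])
    then show "e u \<noteq> e t"
      using dS(2)[OF ut(1)] cS4[OF ut(1)] bspec[OF free ut(1)] dq(3,4,6) dT(2)[OF ut(2)] ut(3) by metis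
  qed
  have d: "proper G 4 d"
  proof (rule properI)
    fix v assume "v \<in> S \<union> T"
    then show "d v \<in> {1..4}" using proper_range[OF clean_proper[OF c], of v] z by (auto simp: d_def)
  next
    fix u v assume "u \<in> S" "v \<in> S" "E u v"
    then show "d u \<noteq> d v" using clean_neq[OF c] dS by metis
  next
    fix t t' assume "t \<in> T" "t' \<in> T" "E t t'"
    from pair_E[OF pair this] show "d t \<noteq> d t'" using dq ds cpr4 z4 by (metis (full_types))
  next
    fix u t assume ut: "u \<in> S" "t \<in> T" "E u t"
    have "c u \<noteq> c t" by (rule clean_neq[OF c ut(3)])
    then show "d u \<noteq> d t"
      using dS(1)[OF ut(1)] cS4[OF ut(1)] bspec[OF free ut(1)] dq(1,2,5) dT(1)[OF ut(2)] ut(3) by metis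
  qed
  have "eqv c e"
    by (rule eqv_two_colors[OF clean_proper[OF c] e, of z 4]) (use c4 pT in \<open>auto simp: e_def\<close>)
  also have "eqv e d"
  proof (rule eqv_independent[OF e d])
    have same: "e v = d v" if "v \<noteq> p" "v \<noteq> r" for v using that by (simp add: d_def e_def)
    fix u v assume "E u v"
    then show "e u = d u \<or> e v = d v"
      using same[of u] same[of v] pair_not_E[OF pair] E_sym E_irrefl by metis
  qed
  finally show "eqv c d" .
  show "clean {q} d \<and> admissible {q}" if qs: "q = s"
  proof
    have "d v \<in> {1, 2, 3}" if "v \<in> S \<union> {q}" for v
      using that dS(1) cS dq(1) z by (cases "v = q") auto
    moreover have "d t = 4" if "t \<in> T - {q}" for t
      using that dT(1)[of t] dq(2,5) qs by (cases "t = p"; cases "t = r") auto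
    ultimately show "clean {q} d" using d by (simp add: clean_def)
    show "admissible {q}"
      unfolding admissible_def
    proof (intro conjI ballI)
      fix t t' assume "t \<in> T - {q}" "t' \<in> T - {q}"
      then show "\<not> E t t'" using pair_E[OF pair, of t t'] qs by blast
    next
      fix t assume "t \<in> {q}"
      then show "\<exists>t'\<in>T - {q}. E t t'" using pair_E_pq[OF pair] E_sym pT by blast
    qed (use pT in blast)
  qed
  show "clean {q, r} d \<and> pair q r p s" if qs: "q \<noteq> s"
  proof
    have "d v \<in> {1, 2, 3}" if "v \<in> S \<union> {q, r}" for v
      using that dS(1) cS dq(1,5) z cpr qs by (cases "v = q"; cases "v = r") auto
    moreover have "d t = 4" if "t \<in> T - {q, r}" for t
      using that dT(1)[of t] dq(2) by (cases "t = p") auto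
    ultimately show "clean {q, r} d" using d by (simp add: clean_def)
    show "pair q r p s" using pair qs by (auto simp: pair_def insert_commute)
  qed
qed

section \<open>Resolving the prism by exchanging an exceptional vertex\<close>

lemma stuck_split_coloring:
  assumes pair: "pair p r q s" and st: "stuck p r u v x y c" and xy: "x \<noteq> y"
  shows "\<exists>\<chi>. split_coloring \<chi>"
proof -
  note pT = pair_T[OF pair]
  \<comment> \<open>With \<open>x\<close> and \<open>y\<close> distinct the edges inside
    \<open>S\<close> form the path \<open>x\<close>, \<open>u\<close>, \<open>v\<close>,
    \<open>y\<close>, whose color classes are \<open>{u, y}\<close> and
    \<open>{v, x}\<close>.\<close>
  define \<chi> :: "'a \<Rightarrow> nat" where "\<chi> = (\<lambda>w. if w \<in> S then if w \<in> {u, y} then 1 else 2 else if w \<in> {p, r} then 3 else 4)"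
  have uv: "u \<noteq> v" "u \<noteq> x" "v \<noteq> y" "u \<noteq> y" "v \<noteq> x" using st by (auto simp: stuck_def)
  have \<chi>T: "\<chi> t = (if t \<in> {p, r} then 3 else 4)" if "t \<in> T" for t using that disj by (auto simp: \<chi>_def)
  have "proper G 4 \<chi>"
  proof (rule properI)
    fix a b assume ab: "a \<in> S" "b \<in> S" "E a b"
    show "\<chi> a \<noteq> \<chi> b" using stuck_E[OF pair st ab] uv xy ab by (auto simp: \<chi>_def)
  next
    fix t t' assume t: "t \<in> T" "t' \<in> T" "E t t'"
    show "\<chi> t \<noteq> \<chi> t'" using pair_E[OF pair t] \<chi>T t pT by auto
  next
    fix a t assume "a \<in> S" "t \<in> T" "E a t"
    then show "\<chi> a \<noteq> \<chi> t" using \<chi>T[of t] by (auto simp: \<chi>_def)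
  qed (auto simp: \<chi>_def)
  then have "split_coloring \<chi>" using \<chi>T by (auto simp: split_coloring_def \<chi>_def)
  then show ?thesis by blast
qed

text \<open>All edges inside \<open>S\<close> lie on the path, so the other vertices of
  \<open>S\<close> are independent and are constrained only by \<open>p\<close> and
  \<open>r\<close>.\<close>

lemma recolor_rest:
  assumes pair: "pair p r q s" and st: "stuck p r u v x y c"
    and f: "\<And>w. w \<in> S - {u, v, x, y} \<Longrightarrow> f w \<in> {1, 2, 3}"
      "\<And>w. w \<in> S - {u, v, x, y} \<Longrightarrow> E w p \<Longrightarrow> f w \<noteq> c p"
      "\<And>w. w \<in> S - {u, v, x, y} \<Longrightarrow> E w r \<Longrightarrow> f w \<noteq> c r"
  defines "d \<equiv> \<lambda>w. if w \<in> S - {u, v, x, y} then f w else c w"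
  shows "stuck p r u v x y d \<and> eqv c d"
proof -
  note pT = pair_T[OF pair]
  have c: "clean {p, r} c" using st by (simp add: stuck_def)
  have dT: "d t = c t" if "t \<in> T" for t using that disj by (auto simp: d_def)
  have d: "clean {p, r} d"
  proof (rule clean_pairI[OF pair])
    show "d w \<in> {1, 2, 3}" if "w \<in> S \<union> {p, r}" for w
      using f(1)[of w] clean_range[OF c that] unfolding d_def by presburger
    show "d t = 4" if "t \<in> T - {p, r}" for t using clean_four[OF c that] dT that by simp
    show "d a \<noteq> d p" if "a \<in> S" "E a p" for a
      using clean_neq[OF c that(2)] dT[OF pT(1)] f(2)[of a] that unfolding d_def by presburger
    show "d a \<noteq> d r" if "a \<in> S" "E a r" for a
      using clean_neq[OF c that(2)] dT[OF pT(2)] f(3)[of a] that unfolding d_def by presburger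
    show "d a \<noteq> d b" if "a \<in> S" "b \<in> S" "E a b" for a b
      using stuck_E[OF pair st that] clean_neq[OF c that(3)] unfolding d_def by auto
  qed
  have "stuck p r u v x y d"
    using st d dT[OF pT(1)] dT[OF pT(2)] unfolding stuck_def by (auto simp: d_def)
  moreover have "eqv c d"
  proof (rule eqv_independent[OF clean_proper[OF c] clean_proper[OF d]])
    fix a b assume ab: "E a b"
    show "c a = d a \<or> c b = d b"
    proof (cases "a \<in> S \<and> b \<in> S")
      case True
      then show ?thesis using stuck_E[OF pair st _ _ ab] by (auto simp: d_def)
    qed (auto simp: d_def)
  qed
  ultimately show ?thesis ..
qed

text \<open>To exchange \<open>p\<close> for \<open>q\<close>, some color must be absent from the
  neighbors of \<open>q\<close> in \<open>S\<close>. The 3-coloring \<open>\<psi>\<close> supplies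
  it: according to whether \<open>\<psi> q\<close> equals \<open>\<psi> u\<close>, equals
  \<open>\<psi> v\<close> or is the third color, the colors \<open>c r\<close>, \<open>c p\<close>
  or \<open>c x\<close> can be freed by recoloring \<open>S\<close> off the path. Without
  \<open>\<psi>\<close> the vertex \<open>q\<close> might see all three colors.\<close>

lemma stuck_eqv_split:
  assumes pair: "pair p r q s" and st: "stuck p r u v x y c" and xy: "x \<noteq> y"
    and \<chi>: "split_coloring \<chi>"
    and \<psi>: "\<And>w. w \<in> S \<union> T \<Longrightarrow> \<psi> w \<in> {1, 2, 3 :: nat}" "\<And>a b. E a b \<Longrightarrow> \<psi> a \<noteq> \<psi> b"
  shows "eqv c \<chi>"
proof (cases "equalizable p r c")
  case True
  then show ?thesis by (rule eqv_split_equalizable[OF \<chi> pair])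
next
  case False
  note pT = pair_T[OF pair]
  note adj = stuck_adjacent[OF pair st xy False]
  have c: "clean {p, r} c" and S: "u \<in> S" "v \<in> S" "x \<in> S" "y \<in> S"
    and cs: "c u = c r" "c v = c p" "c y = c x" "c r \<noteq> c p" "c x \<noteq> c p" "c x \<noteq> c r"
    and e: "E u v" "E u x" "E v y"
    using st by (auto simp: stuck_def)
  have ne: "u \<noteq> v" "x \<noteq> u" "x \<noteq> v" "y \<noteq> u" "y \<noteq> v" using cs by metis+
  have cK: "c p \<in> {1, 2, 3}" "c r \<in> {1, 2, 3}" "c x \<in> {1, 2, 3}" using clean_range[OF c] S by blast+
  have three: "\<psi> d = \<psi> c" if "\<psi> a \<noteq> \<psi> b" "\<psi> a \<noteq> \<psi> c" "\<psi> b \<noteq> \<psi> c" "\<psi> d \<noteq> \<psi> a" "\<psi> d \<noteq> \<psi> b"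
    and "a \<in> S \<union> T" "b \<in> S \<union> T" "c \<in> S \<union> T" "d \<in> S \<union> T" for a b c d
    using \<psi>(1)[OF that(6)] \<psi>(1)[OF that(7)] \<psi>(1)[OF that(8)] \<psi>(1)[OF that(9)] that(1-5)
    unfolding insert_iff empty_iff by (smt (verit))
  have \<psi>ne: "\<psi> u \<noteq> \<psi> p" "\<psi> x \<noteq> \<psi> p" "\<psi> y \<noteq> \<psi> p" "\<psi> v \<noteq> \<psi> r" "\<psi> x \<noteq> \<psi> r" "\<psi> y \<noteq> \<psi> r"
    "\<psi> u \<noteq> \<psi> v" "\<psi> u \<noteq> \<psi> x" "\<psi> v \<noteq> \<psi> y" "\<psi> p \<noteq> \<psi> q"
    using adj e pair_E_pq[OF pair] \<psi>(2) by blast+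
  have finish: "eqv d \<chi>" if d: "eqv d d'" "q = s \<Longrightarrow> clean {q} d' \<and> admissible {q}"
    "q \<noteq> s \<Longrightarrow> pair q r p s \<and> equalizable q r d'" for d d'
  proof (cases "q = s")
    case True
    then show ?thesis using d eqv_split_single[OF \<chi>] eqv_trans by blast
  next
    case False
    then show ?thesis using d eqv_split_equalizable[OF \<chi>] eqv_trans by blast
  qed
  show ?thesis
  proof (cases "\<psi> q = \<psi> u \<or> \<psi> q = \<psi> v")
    case True
    \<comment> \<open>Off the path everything takes the third color, so \<open>u\<close> is the only
      vertex of \<open>S\<close> with color \<open>c r\<close> and \<open>v\<close> the only one
      with color \<open>c p\<close>.\<close>
    define d where "d = (\<lambda>w. if w \<in> S - {u, v, x, y} then c x else c w)"
    have d: "stuck p r u v x y d" "eqv c d"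
      using recolor_rest[OF pair st, of "\<lambda>_. c x"] cK cs unfolding d_def by blast+
    have dclean: "clean {p, r} d" using d(1) by (simp add: stuck_def)
    have dS: "d w = c x" if "w \<in> S" "w \<noteq> u" "w \<noteq> v" for w
      using that cs(3) by (auto simp: d_def)
    have dpr: "d p = c p" "d r = c r" using pT by (simp_all add: d_def)
    have duv: "d u = c r" "d v = c p" using cs(1,2) by (simp_all add: d_def)
    show ?thesis
    proof (cases "\<psi> q = \<psi> u")
      case True
      have free: "\<forall>w\<in>S. E w q \<longrightarrow> d w \<noteq> c r"
      proof (intro ballI impI)
        fix w assume that: "w \<in> S" "E w q"
        have "w \<noteq> u" using \<psi>(2)[OF that(2)] True by auto
        then show "d w \<noteq> c r" using dS[OF that(1)] duv cs by (cases "w = v") auto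
      qed
      define d' where "d' = d(q := c r, p := 4, r := if q = s then 4 else d r)"
      note ex = exchange_exceptional[OF pair dclean cK(2) free, folded d'_def]
      have "equalizable q r d'" if "q \<noteq> s"
      proof -
        have cl: "clean {q, r} d'" using ex(3)[OF that] by (rule conjunct1)
        have "d' q = d' r" using that dpr(2) pT(10,11) by (simp add: d'_def)
        then show ?thesis
          unfolding equalizable_def using cl eqv_refl[OF clean_proper[OF cl]] by (intro exI conjI)
      qed
      then show ?thesis
        using finish[OF ex(1) ex(2)] conjunct2[OF ex(3)] eqv_trans[OF d(2)] by blast
    next
      case False
      then have qv: "\<psi> q = \<psi> v" using True by blast
      \<comment> \<open>The prism forces \<open>x\<close> into the class of \<open>v\<close> and
        \<open>q\<close>, so \<open>x\<close> is not adjacent to \<open>q\<close>. After the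
        exchange the prism is broken at the missing edge \<open>x q\<close>.\<close>
      have "\<psi> x = \<psi> v"
        by (rule three[of p u v x]) (use \<psi>ne qv S pT in \<open>metis UnI1 UnI2\<close>)+
      then have xq: "\<not> E x q" using \<psi>(2)[of x q] qv by auto
      have free: "\<forall>w\<in>S. E w q \<longrightarrow> d w \<noteq> c p"
      proof (intro ballI impI)
        fix w assume that: "w \<in> S" "E w q"
        have "w \<noteq> v" using \<psi>(2)[OF that(2)] qv by auto
        then show "d w \<noteq> c p" using dS[OF that(1)] duv cs by (cases "w = u") auto
      qed
      define d' where "d' = d(q := c p, p := 4, r := if q = s then 4 else d r)"
      note ex = exchange_exceptional[OF pair dclean cK(1) free, folded d'_def]
      have "equalizable q r d'" if "q \<noteq> s"
      proof (rule stuck_not_E_x_p[OF _ _ xy xq])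
        show "pair q r p s" using ex(3)[OF that] by (rule conjunct2)
        have dw: "d' w = d w" if "w \<in> S" for w using that pT(5-7) by (auto simp: d'_def)
        have dq: "d' q = c p" "d' r = c r" using that dpr(2) pT(10,11) by (simp_all add: d'_def)
        show "stuck q r u v x y d'"
          using d(1) conjunct1[OF ex(3)[OF that]]
          unfolding stuck_def dw[OF S(1)] dw[OF S(2)] dw[OF S(3)] dw[OF S(4)] dq dpr
          by (elim conjE) (intro conjI; assumption)
      qed
      then show ?thesis
        using finish[OF ex(1) ex(2)] conjunct2[OF ex(3)] eqv_trans[OF d(2)] by blast
    qed
  next
    case False
    then have \<psi>q: "\<psi> q \<noteq> \<psi> u" "\<psi> q \<noteq> \<psi> v" by blast+
    \<comment> \<open>When \<open>\<psi> q\<close> is the third color, \<open>\<psi>\<close>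
      partitions the six prism vertices exactly as \<open>c\<close> does.\<close>
    have \<psi>p: "\<psi> p = \<psi> v"
      by (rule three[of u q v p]) (use \<psi>ne \<psi>q S pT in \<open>metis UnI1 UnI2\<close>)+
    have \<psi>x: "\<psi> x = \<psi> q"
      by (rule three[of u v q x]) (use \<psi>ne \<psi>q \<psi>p S pT in \<open>metis UnI1 UnI2\<close>)+
    have \<psi>r: "\<psi> r = \<psi> u"
      by (rule three[of v q u r]) (use \<psi>ne \<psi>q \<psi>x S pT in \<open>metis UnI1 UnI2\<close>)+
    have \<psi>y: "\<psi> y = \<psi> q"
      by (rule three[of u v q y]) (use \<psi>ne \<psi>q \<psi>r S pT in \<open>metis UnI1 UnI2\<close>)+
    note \<psi>e = \<psi>p \<psi>x \<psi>r \<psi>y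
    \<comment> \<open>The classes of \<open>\<psi>\<close>, renamed to the colors of
      \<open>c\<close> on the prism, color the rest of \<open>S\<close>; the vertices colored
      \<open>c x\<close> then belong to the class of \<open>q\<close> and are not adjacent to
      it.\<close>
    let ?f = "\<lambda>w. if \<psi> w = \<psi> u then c r else if \<psi> w = \<psi> v then c p else c x"
    define d where "d = (\<lambda>w. if w \<in> S - {u, v, x, y} then ?f w else c w)"
    have d: "stuck p r u v x y d \<and> eqv c d"
      unfolding d_def
    proof (rule recolor_rest[OF pair st])
      fix w assume "w \<in> S - {u, v, x, y}"
      show "?f w \<in> {1, 2, 3}" using cK by presburger
      show "?f w \<noteq> c p" if "E w p" using \<psi>(2)[OF that] \<psi>e cs by auto
      show "?f w \<noteq> c r" if "E w r" using \<psi>(2)[OF that] \<psi>e cs by auto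
    qed
    have dclean: "clean {p, r} d" using d by (simp add: stuck_def)
    have dpr: "d p = c p" "d r = c r" using pT by (simp_all add: d_def)
    have dS: "d u = c r" "d v = c p" "d x = c x" "d y = c x" using cs by (simp_all add: d_def)
    have free: "\<forall>w\<in>S. E w q \<longrightarrow> d w \<noteq> c x"
    proof (intro ballI impI)
      fix w assume that: "w \<in> S" "E w q"
      have "\<psi> w \<noteq> \<psi> q" by (rule \<psi>(2)[OF that(2)])
      moreover from this have "\<psi> w = \<psi> v" if "\<psi> w \<noteq> \<psi> u"
        using three[of u q v w] that \<psi>ne(7) \<psi>q S pT \<open>w \<in> S\<close> by (metis UnI1 UnI2)
      ultimately have "\<psi> w = \<psi> u \<or> \<psi> w = \<psi> v" "w \<noteq> x" "w \<noteq> y"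
        using \<psi>e by metis+
      then show "d w \<noteq> c x" using dS cs that(1) ne unfolding d_def
        by (metis Diff_iff empty_iff insert_iff)
    qed
    define d' where "d' = d(q := c x, p := 4, r := if q = s then 4 else d r)"
    note ex = exchange_exceptional[OF pair dclean cK(3) free, folded d'_def]
    have "equalizable q r d'" if qs: "q \<noteq> s"
    proof -
      have cl: "clean {q, r} d'" and pair': "pair q r p s" using ex(3)[OF qs] by blast+
      have dw: "d' w = d w" if "w \<in> S" for w using that pT(5-7) by (auto simp: d'_def)
      have dq: "d' q = c x" "d' r = c r" using qs dpr(2) pT(10,11) by (simp_all add: d'_def)
      note dw' = dw[OF S(1)] dw[OF S(2)] dw[OF S(3)] dw[OF S(4)]
      have xq: "\<not> E x q" using \<psi>(2)[of x q] \<psi>e by auto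
      \<comment> \<open>Now \<open>q\<close> has color \<open>c x\<close> and \<open>x\<close> does
        not see it. Moving \<open>x\<close> to \<open>c p\<close> leaves no edge inside
        \<open>S\<close> in the colors \<open>c r\<close> and \<open>c x\<close> of the new
        exceptional vertices.\<close>
      let ?e = "d'(x := c p)"
      have e: "clean {q, r} ?e \<and> eqv d' ?e"
      proof (rule recolor_S[OF pair' cl S(3) cK(1)])
        fix z assume z: "E x z" "z \<in> S \<union> {q, r}"
        show "d' z \<noteq> c p"
        proof (cases "z \<in> S")
          case True
          then have "z = u" using stuck_E[OF pair st S(3) True z(1)] ne xy by auto
          then show ?thesis using dw' dS cs by metis
        next
          case False
          then have "z = r" using z xq by blast
          then show ?thesis using dq cs by metis
        qed
      qed
      have "equalizable q r ?e"
      proof (rule equalizable_swap[OF pair' conjunct1[OF e]])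
        fix a b assume ab: "a \<in> S" "b \<in> S" "E a b" "?e a = ?e r" "?e b = ?e q"
        have "?e r = c r" "?e q = c x" using dq S pT by auto
        moreover have "?e u = c r" "?e v = c p" "?e x = c p" "?e y = c x"
          using dw' dS ne xy by auto
        ultimately show "\<not> E b r" using stuck_E[OF pair st ab(1-3)] ab(4,5) cs by metis
      qed
      then show ?thesis using equalizable_eqv e by blast
    qed
    then show ?thesis
      using finish[OF ex(1) ex(2)] conjunct2[OF ex(3)] eqv_trans[OF conjunct2[OF d]] by blast
  qed
qed

section \<open>Comparison with a 3-coloring of the whole graph\<close>

lemma eqv_three_coloring_pair:
  assumes pair: "pair p r q s" and c: "clean {p, r} c"
    and \<psi>: "proper G 4 \<psi>" "\<And>v. v \<in> S \<union> T \<Longrightarrow> \<psi> v \<in> {1, 2, 3}"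
  shows "eqv c \<psi>"
proof -
  obtain d where d: "clean {p, r} d" "eqv \<psi> d"
    using three_coloring_clean[OF \<psi> pair_admissible[OF pair]] by blast
  show ?thesis
  proof (cases "\<exists>u v x. {u, v, x} \<subseteq> S \<and> E u v \<and> E u x \<and> E v x")
    case True
    then have "eqv c d" using eqv_clean_triangle[OF pair _ _ _ _ c d(1)] by blast
    then show ?thesis using d(2) eqv_sym eqv_trans by blast
  next
    case no_triangle: False
    have cases: "equalizable p r e \<or> (\<exists>u v x y e'. stuck p r u v x y e' \<and> x \<noteq> y \<and> eqv e e')"
      if e: "clean {p, r} e" for e
    proof (cases "e p = e r")
      case True
      then show ?thesis using e eqv_refl[OF clean_proper[OF e]] unfolding equalizable_def by blast
    next
      case False
      have "x \<noteq> y" if "stuck p r u v x y e'" for u v x y e'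
        using that no_triangle unfolding stuck_def by blast
      then show ?thesis using equalizable_or_stuck[OF pair e False] by blast
    qed
    show ?thesis
    proof (cases "\<exists>\<chi>. split_coloring \<chi>")
      case True
      then obtain \<chi> where \<chi>: "split_coloring \<chi>" ..
      have "eqv e \<chi>" if e: "clean {p, r} e" for e
        using cases[OF e]
      proof
        assume "equalizable p r e"
        then show ?thesis by (rule eqv_split_equalizable[OF \<chi> pair])
      next
        assume "\<exists>u v x y e'. stuck p r u v x y e' \<and> x \<noteq> y \<and> eqv e e'"
        then obtain u v x y e' where st: "stuck p r u v x y e'" "x \<noteq> y" "eqv e e'" by blast
        have "eqv e' \<chi>"
          by (rule stuck_eqv_split[OF pair st(1,2) \<chi> \<psi>(2)]) (use proper_neq[OF \<psi>(1)] in auto)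
        then show ?thesis using st(3) eqv_trans by blast
      qed
      then show ?thesis using c d eqv_trans eqv_sym by meson
    \<comment> \<open>A stuck coloring would provide a split coloring, so here both colorings are
      equalizable and can be compared directly.\<close>
    next
      case False
      then have "equalizable p r c" "equalizable p r d"
        using cases[OF c] cases[OF d(1)] stuck_split_coloring[OF pair] by blast+
      then obtain c' d' where "clean {p, r} c'" "c' p = c' r" "eqv c c'"
        "clean {p, r} d'" "d' p = d' r" "eqv d d'"
        unfolding equalizable_def by blast
      then show ?thesis using eqv_clean_equal[OF pair, of c' d'] d(2) eqv_trans eqv_sym by meson
    qed
  qed
qed

theorem eqv_three_coloring:
  assumes c: "proper G 4 c" and \<psi>: "proper G 4 \<psi>" "\<And>v. v \<in> S \<union> T \<Longrightarrow> \<psi> v \<in> {1, 2, 3}"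
  shows "eqv c \<psi>"
proof -
  obtain Q d where Q: "admissible Q" and d: "clean Q d" "eqv c d" using eqv_clean[OF c] by blast
  obtain e where e: "clean Q e" "eqv \<psi> e" using three_coloring_clean[OF \<psi> Q] by blast
  have "finite Q" using Q finite_sides by (auto simp: admissible_def intro: finite_subset)
  have "card Q \<le> 2" using card_admissible[OF Q] F_few(2) by linarith
  then consider "card Q = 0" | "card Q = 1" | "card Q = 2" by linarith
  then have "eqv d \<psi>"
  proof cases
    case 1
    \<comment> \<open>\<open>Q\<close> is empty, so the vertex that bounds it is arbitrary.\<close>
    then have "eqv d e" using eqv_clean_single[OF Q, of undefined d e] d e \<open>finite Q\<close> by simp
    then show ?thesis using e(2) eqv_trans eqv_sym by blast
  next
    case 2
    then obtain q where "Q = {q}" by (meson card_1_singletonE)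
    then have "eqv d e" using eqv_clean_single[OF Q, of q d e] d e by simp
    then show ?thesis using e(2) eqv_trans eqv_sym by blast
  next
    case 3
    then obtain p r where pr: "Q = {p, r}" "p \<noteq> r" by (meson card_2_iff)
    obtain q s where "pair p r q s" using pair_obtain Q pr by metis
    then show ?thesis using eqv_three_coloring_pair d(1) \<psi> pr(1) by blast
  qed
  then show ?thesis using d(2) eqv_trans by blast
qed

end

section \<open>Kempe classes\<close>

text \<open>Edges of \<open>B\<close> cross between the sides, so the edges inside \<open>S\<close>
  or \<open>T\<close> all come from \<open>F\<close>. If more than two of them lie in
  \<open>T\<close>, at most two lie in \<open>S\<close> and the sides trade roles.\<close>

lemma bipartite_plus_near_bipartite:
  assumes "l \<le> 5" "bipartite_plus l G"
  obtains S T where "near_bipartite G S T"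
proof -
  obtain B S T F where B: "bipartite B S T" and F: "finite F" "card F = l"
    "\<forall>e\<in>F. card e = 2 \<and> (e \<subseteq> S \<or> e \<subseteq> T)" and G: "G = (verts B, edges B \<union> F)"
    using assms(2) unfolding bipartite_plus_def by blast
  have disj: "S \<inter> T = {}" and verts: "verts G = S \<union> T" using B G by (auto simp: bipartite_def)
  define FS FT where "FS = {e \<in> edges G. e \<subseteq> S}" and "FT = {e \<in> edges G. e \<subseteq> T}"
  have "e \<in> F" if "e \<in> edges G" "e \<subseteq> S \<or> e \<subseteq> T" for e
    using that B G disj unfolding bipartite_def by fastforce
  then have sub: "FS \<union> FT \<subseteq> F" unfolding FS_def FT_def by blast
  moreover have "FS \<inter> FT = {}"
  proof -
    have "{} \<notin> F" using F(3) by (metis card.empty zero_neq_numeral)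
    moreover have "e = {}" if "e \<in> FS \<inter> FT" for e
      using that disj unfolding FS_def FT_def by blast
    ultimately show ?thesis using sub by blast
  qed
  ultimately have "card FS + card FT \<le> l"
    using F(1,2) by (metis card_Un_disjoint card_mono finite_Un finite_subset)
  then have few: "card FS + card FT \<le> 5" using assms(1) by simp
  note simple = bipartite_plus_simple[OF assms(2)]
  show ?thesis
  proof (cases "card FT \<le> 2")
    case True
    then have "near_bipartite G S T"
      using simple verts disj few by unfold_locales (auto simp: FS_def FT_def)
    then show ?thesis by (rule that)
  next
    case False
    then have "near_bipartite G T S"
      using simple verts disj few by unfold_locales (auto simp: FS_def FT_def)
    then show ?thesis by (rule that)
  qed
qed

theorem theorem2:
  fixes G :: "'a ugraph" and l :: nat
  assumes "l \<le> 5" and "bipartite_plus l G" and "colorable G 3"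
  shows "Kc G 4 = 1 \<and> (\<forall>c \<in> colorings G 4. \<forall>d \<in> colorings G 4. (c, d) \<in> kempe_equiv G 4)"
proof -
  obtain S T where "near_bipartite G S T"
    using bipartite_plus_near_bipartite[OF assms(1,2)] by blast
  then interpret near_bipartite G S T .
  obtain \<psi> where \<psi>: "\<psi> \<in> colorings G 3" using assms(3) by (auto simp: colorable_def)
  have \<psi>3: "\<psi> v \<in> {1, 2, 3}" if "v \<in> S \<union> T" for v
  proof -
    have "\<psi> v \<in> {1..3}" using \<psi> that verts_eq by (auto simp: colorings_def)
    then show ?thesis by auto
  qed
  have \<psi>4: "\<psi> \<in> colorings G 4"
    using \<psi> unfolding colorings_def by fastforce
  note \<psi>p = coloring_proper[OF simple \<psi>4]
  have all: "(c, d) \<in> kempe_equiv G 4" if "c \<in> colorings G 4" "d \<in> colorings G 4" for c d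
  proof -
    have "eqv c \<psi>" "eqv d \<psi>"
      using that coloring_proper[OF simple] eqv_three_coloring[OF _ \<psi>p \<psi>3] by blast+
    then have "eqv c d" using eqv_sym eqv_trans by blast
    then show ?thesis using that by (simp add: keq_def coloring_restrict)
  qed
  have "kempe_equiv G 4 `` {c} = colorings G 4" if "c \<in> colorings G 4" for c
    using all that by (auto simp: kempe_equiv_def)
  \<comment> \<open>The 3-coloring also makes the set of 4-colorings nonempty, so there is exactly
    one class and not zero.\<close>
  then have "colorings G 4 // kempe_equiv G 4 = {colorings G 4}"
    using \<psi>4 by (auto simp: quotient_def)
  then show ?thesis using all by (simp add: Kc_def)
qed

end
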